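(* A circuit is erasable if and only if it is sequentializable. In particular, the circuit translation of every MALL proof is erasable.
   Context: Fix literals with an involution $a\mapsto\bar a$ ($\bar a\ne a$, $\bar{\bar a}=a$); MALL formulas are built from literals by $\otimes,⅋,\&,\oplus$; sequents are finite lists of formulas. MALL proofs use the rules: axiom $\vdash P,\bar P$ ($P$ a literal); permutation (from $A_1,\dots,A_n$ infer $A_{\sigma1},\dots,A_{\sigma n}$); $⅋$ (from $\Gamma,A,B$ infer $\Gamma,A⅋B$); $\oplus_i$, $i\in\{0,1\}$ (from $\Gamma,A_i$ infer $\Gamma,A_0\oplus A_1$); $\otimes$ (from $\Gamma,A$ and $B,\Delta$ infer $\Gamma,A\otimes B,\Delta$); $\&$ (from $\Gamma,A$ and $\Gamma,B$ infer $\Gamma,A\&B$). A circuit consists of a finite non-empty set of nodes and a finite set of wires; each wire is labelled by a formula, has a source node and possibly a target node distinct from the source; a wire with no target is an exit. Each node is of one of the kinds: axiom (source of two wires labelled by dual literals, target of none); contraction (target of two wires, source of one, all three with the same formula); binary of type $\otimes$, $⅋$ or $\&$ (target of a designated left wire labelled $A$ and right wire labelled $B$, source of one wire labelled $A\square B$ where $\square$ is its type); plus (target of one wire designated left or right, labelled $A$, source of one wire labelled $A\oplus B$ if left, $B\oplus A$ if right, for some $B$). The underlying undirected graph (nodes joined by wires) is connected, and the exits are linearly ordered; the list of exit formulas is the conclusion. A node is final if it is the source of an exit. A node $N$ is ready if it is final and: $N$ is a plus node; or $N$ is a $\otimes$ node and deleting $N$ (with its exit) leaves exactly two connected components; or $N$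 is a $⅋$ node and deleting $N$ leaves the circuit connected; or $N$ is a $\&$ node, every other final node is a contraction node, deleting all final nodes with their exits leaves exactly two connected components $X_1,X_2$, and every final node has one incoming wire in $X_1$ and the other in $X_2$; or $N$ is an axiom node and the only node. Deleting a node turns its incoming wires into exits. For ready $N$, $X\leadsto_N S$ where $S$ is the set of connected components obtained by deleting $N$ (in the $\&$ case: deleting all final nodes, giving $\{X_1,X_2\}$; in the axiom case $S=\emptyset$), each made into a circuit with an exit order induced from that of $X$. For finite sets of circuits, $T\leadsto U$ if $T=T'\cup\{X\}$ (disjoint), $X\leadsto_N S$ for some ready $N$, and $U=T'\cup S$. A circuit $X$ is erasable if $\{X\}\leadsto^*\emptyset$. Translation of a proof to a circuit, by induction: axiom $\vdash P,\bar P$ gives one axiom node with exits $P,\bar P$ in that order; permutation $\sigma$ permutes the exit order; $⅋$ adds a $⅋$ node targeted by the last two exits (the last one right), with new exit $A⅋B$ placed last; $\oplus_i$ adds a plus node targeted by the last exit (designated left if $i=0$, right if $i=1$), new exit $A_0\oplus A_1$ placed last; $\otimes$ takes the disjoint union of the two premise circuits, adds a $\otimes$ node targeted by the last exit of the first (left) and first exit of the second (right), with exit order: remaining exits of the first, then the new exit $A\otimes B$, then remaining exits of the second; $\&$ (premises $B_1,\dots,B_n,A_i$) takes the disjoint union, adds a $\&$ node targeted by the last exits (left from the first premise), and for each $j\le n$ a contraction node targeted by the $j$-th exits of both, with new exits ordered $B_1,\dots,B_n,A_0\&A_1$. A circuit is sequentializable if it is (isomorphic to) the translation of some proof. *)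

theory Defs
  imports Main
begin

section \<open>MALL formulas and proofs\<close>

datatype 'a form = Lit 'a | Tens "'a form" "'a form" | Par "'a form" "'a form"
  | With "'a form" "'a form" | Plus "'a form" "'a form"

(* Proof trees.  PPerm ss: from A_0..A_{n-1} infer A_{ss!0},...,A_{ss!(n-1)} (ss a permutation of [0..<n]);
   PPlus i B: i = False is rule oplus_0 (A_0 = premise formula, A_1 = B),
              i = True is rule oplus_1 (A_1 = premise formula, A_0 = B). *)
datatype 'a mproof =
    PAx 'a
  | PPerm "nat list" "'a mproof"
  | PPar "'a mproof"
  | PPlus bool "'a form" "'a mproof"
  | PTens "'a mproof" "'a mproof"
  | PWith "'a mproof" "'a mproof"

(* conclusion of a proof tree; None if the tree is not a correct MALL proof *)
fun concl :: "('a \<Rightarrow> 'a) \<Rightarrow> 'a mproof \<Rightarrow> 'a form list option" where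
  "concl d (PAx P) = Some [Lit P, Lit (d P)]"
| "concl d (PPerm ss p) = (case concl d p of None \<Rightarrow> None
     | Some G \<Rightarrow> if distinct ss \<and> set ss = {..<length G} then Some (map (\<lambda>i. G ! i) ss) else None)"
| "concl d (PPar p) = (case concl d p of None \<Rightarrow> None
     | Some G \<Rightarrow> if 2 \<le> length G
         then Some (take (length G - 2) G @ [Par (G ! (length G - 2)) (G ! (length G - 1))]) else None)"
| "concl d (PPlus i B p) = (case concl d p of None \<Rightarrow> None
     | Some G \<Rightarrow> if G \<noteq> [] then Some (butlast G @ [if i then Plus B (last G) else Plus (last G) B])
                  else None)"
| "concl d (PTens p q) = (case (concl d p, concl d q) of
       (Some G, Some H) \<Rightarrow> if G \<noteq> [] \<and> H \<noteq> [] then Some (butlast G @ [Tens (last G) (hd H)] @ tl H) else None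
     | _ \<Rightarrow> None)"
| "concl d (PWith p q) = (case (concl d p, concl d q) of
       (Some G, Some H) \<Rightarrow> if G \<noteq> [] \<and> H \<noteq> [] \<and> butlast G = butlast H
          then Some (butlast G @ [With (last G) (last H)]) else None
     | _ \<Rightarrow> None)"

definition is_proof :: "('a \<Rightarrow> 'a) \<Rightarrow> 'a mproof \<Rightarrow> bool" where
  "is_proof d p \<longleftrightarrow> concl d p \<noteq> None"

section \<open>Circuits\<close>

datatype binop = BTens | BPar | BWith
datatype kind = KAx | KContr | KBin binop | KPlus

fun binf :: "binop \<Rightarrow> 'a form \<Rightarrow> 'a form \<Rightarrow> 'a form" where
  "binf BTens = Tens" | "binf BPar = Par" | "binf BWith = With"

(* isleft w: designation (left/right) of a wire entering a binary or plus node;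
   irrelevant (junk) for other wires.  tgt w = None means w is an exit.
   exits: the linear order of the exits. *)
record ('n, 'w, 'a) circuit =
  nodes :: "'n set"
  wires :: "'w set"
  src :: "'w \<Rightarrow> 'n"
  tgt :: "'w \<Rightarrow> 'n option"
  lab :: "'w \<Rightarrow> 'a form"
  kind :: "'n \<Rightarrow> kind"
  isleft :: "'w \<Rightarrow> bool"
  exits :: "'w list"

definition In :: "('n, 'w, 'a) circuit \<Rightarrow> 'n \<Rightarrow> 'w set" where
  "In X n = {w \<in> wires X. tgt X w = Some n}"

definition Out :: "('n, 'w, 'a) circuit \<Rightarrow> 'n \<Rightarrow> 'w set" where
  "Out X n = {w \<in> wires X. src X w = n}"

(* undirected adjacency of the underlying graph *)
definition adj :: "('n, 'w, 'a) circuit \<Rightarrow> ('n \<times> 'n) set" where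
  "adj X = {(src X w, t) | w t. w \<in> wires X \<and> tgt X w = Some t}
         \<union> {(t, src X w) | w t. w \<in> wires X \<and> tgt X w = Some t}"

definition connected_circ :: "('n, 'w, 'a) circuit \<Rightarrow> bool" where
  "connected_circ X \<longleftrightarrow> (\<forall>n\<in>nodes X. \<forall>m\<in>nodes X. (n, m) \<in> (adj X)\<^sup>*)"

definition node_ok :: "('a \<Rightarrow> 'a) \<Rightarrow> ('n, 'w, 'a) circuit \<Rightarrow> 'n \<Rightarrow> bool" where
  "node_ok d X n \<longleftrightarrow> (case kind X n of
      KAx \<Rightarrow> In X n = {} \<and> (\<exists>w1 w2 P. w1 \<noteq> w2 \<and> Out X n = {w1, w2}
                \<and> lab X w1 = Lit P \<and> lab X w2 = Lit (d P))
    | KContr \<Rightarrow> (\<exists>w1 w2 w. w1 \<noteq> w2 \<and> In X n = {w1, w2} \<and> Out X n = {w}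
                \<and> lab X w1 = lab X w \<and> lab X w2 = lab X w)
    | KBin b \<Rightarrow> (\<exists>wl wr w. wl \<noteq> wr \<and> In X n = {wl, wr} \<and> isleft X wl \<and> \<not> isleft X wr
                \<and> Out X n = {w} \<and> lab X w = binf b (lab X wl) (lab X wr))
    | KPlus \<Rightarrow> (\<exists>wi w B. In X n = {wi} \<and> Out X n = {w}
                \<and> lab X w = (if isleft X wi then Plus (lab X wi) B else Plus B (lab X wi))))"

definition is_circuit :: "('a \<Rightarrow> 'a) \<Rightarrow> ('n, 'w, 'a) circuit \<Rightarrow> bool" where
  "is_circuit d X \<longleftrightarrow>
     finite (nodes X) \<and> nodes X \<noteq> {} \<and> finite (wires X)
   \<and> (\<forall>w\<in>wires X. src X w \<in> nodes X \<and> (\<forall>t. tgt X w = Some t \<longrightarrow> t \<in> nodes X \<and> t \<noteq> src X w))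
   \<and> distinct (exits X) \<and> set (exits X) = {w \<in> wires X. tgt X w = None}
   \<and> (\<forall>n\<in>nodes X. node_ok d X n)
   \<and> connected_circ X"

(* wires whose left/right designation is meaningful *)
definition designated :: "('n, 'w, 'a) circuit \<Rightarrow> 'w \<Rightarrow> bool" where
  "designated X w \<longleftrightarrow> (\<exists>t. tgt X w = Some t \<and> kind X t \<noteq> KContr)"

definition iso :: "('n, 'w, 'a) circuit \<Rightarrow> ('m, 'v, 'a) circuit \<Rightarrow> bool" where
  "iso X Y \<longleftrightarrow> (\<exists>f g. bij_betw f (nodes X) (nodes Y) \<and> bij_betw g (wires X) (wires Y)
     \<and> (\<forall>w\<in>wires X. src Y (g w) = f (src X w) \<and> tgt Y (g w) = map_option f (tgt X w)
                    \<and> lab Y (g w) = lab X w \<and> (designated X w \<longrightarrow> isleft Y (g w) = isleft X w))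
     \<and> (\<forall>n\<in>nodes X. kind Y (f n) = kind X n)
     \<and> exits Y = map g (exits X))"

section \<open>Erasure\<close>

definition final :: "('n, 'w, 'a) circuit \<Rightarrow> 'n \<Rightarrow> bool" where
  "final X n \<longleftrightarrow> n \<in> nodes X \<and> (\<exists>w\<in>wires X. src X w = n \<and> tgt X w = None)"

(* incoming wires of a node listed left before right *)
definition in_list :: "('n, 'w, 'a) circuit \<Rightarrow> 'n \<Rightarrow> 'w list" where
  "in_list X n = (SOME xs. distinct xs \<and> set xs = In X n
                   \<and> sorted_wrt (\<lambda>u v. isleft X u \<or> \<not> isleft X v) xs)"

(* delete a set D of (final) nodes together with their outgoing wires; their incoming
   wires become exits, placed where the exit of the deleted node was *)
definition delete :: "('n, 'w, 'a) circuit \<Rightarrow> 'n set \<Rightarrow> ('n, 'w, 'a) circuit" where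
  "delete X D = X\<lparr> nodes := nodes X - D,
                   wires := {w \<in> wires X. src X w \<notin> D},
                   tgt := (\<lambda>w. case tgt X w of None \<Rightarrow> None | Some t \<Rightarrow> if t \<in> D then None else Some t),
                   exits := concat (map (\<lambda>e. if src X e \<in> D then in_list X (src X e) else [e]) (exits X)) \<rparr>"

(* node sets of the connected components *)
definition comps :: "('n, 'w, 'a) circuit \<Rightarrow> 'n set set" where
  "comps X = {{m \<in> nodes X. (n, m) \<in> (adj X)\<^sup>*} | n. n \<in> nodes X}"

definition restrict :: "('n, 'w, 'a) circuit \<Rightarrow> 'n set \<Rightarrow> ('n, 'w, 'a) circuit" where
  "restrict X C = X\<lparr> nodes := C, wires := {w \<in> wires X. src X w \<in> C},
                     exits := filter (\<lambda>w. w \<in> wires X \<and> src X w \<in> C) (exits X) \<rparr>"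

(* the circuits obtained as connected components after deleting D, exit order induced *)
definition parts :: "('n, 'w, 'a) circuit \<Rightarrow> 'n set \<Rightarrow> ('n, 'w, 'a) circuit set" where
  "parts X D = restrict (delete X D) ` comps (delete X D)"

(* erase_at X N S:  N is ready in X and X ~>_N S *)
definition erase_at :: "('n, 'w, 'a) circuit \<Rightarrow> 'n \<Rightarrow> ('n, 'w, 'a) circuit set \<Rightarrow> bool" where
  "erase_at X N S \<longleftrightarrow> final X N \<and>
     ((kind X N = KPlus \<and> S = parts X {N})
    \<or> (kind X N = KBin BTens \<and> card (comps (delete X {N})) = 2 \<and> S = parts X {N})
    \<or> (kind X N = KBin BPar \<and> card (comps (delete X {N})) = 1 \<and> S = parts X {N})
    \<or> (kind X N = KBin BWith \<and>
         (\<forall>m. final X m \<and> m \<noteq> N \<longrightarrow> kind X m = KContr) \<and>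
         (\<exists>X1 X2. X1 \<noteq> X2 \<and> comps (delete X {m. final X m}) = {X1, X2} \<and>
             (\<forall>m. final X m \<longrightarrow> (\<exists>w1\<in>In X m. \<exists>w2\<in>In X m. src X w1 \<in> X1 \<and> src X w2 \<in> X2))) \<and>
         S = parts X {m. final X m})
    \<or> (kind X N = KAx \<and> nodes X = {N} \<and> S = {}))"

definition step_set :: "('n, 'w, 'a) circuit set \<Rightarrow> ('n, 'w, 'a) circuit set \<Rightarrow> bool" where
  "step_set T U \<longleftrightarrow> (\<exists>X T' N S. T = insert X T' \<and> X \<notin> T' \<and> erase_at X N S \<and> U = T' \<union> S)"

definition erasable :: "('n, 'w, 'a) circuit \<Rightarrow> bool" where
  "erasable X \<longleftrightarrow> step_set\<^sup>*\<^sup>* {X} {}"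

section \<open>Translation of proofs to circuits\<close>

(* prefix all node and wire names by k *)
definition pref :: "nat \<Rightarrow> (nat list, nat list, 'a) circuit \<Rightarrow> (nat list, nat list, 'a) circuit" where
  "pref k X = \<lparr> nodes = Cons k ` nodes X, wires = Cons k ` wires X,
                src = (\<lambda>w. k # src X (tl w)), tgt = (\<lambda>w. map_option (Cons k) (tgt X (tl w))),
                lab = (\<lambda>w. lab X (tl w)), kind = (\<lambda>n. kind X (tl n)),
                isleft = (\<lambda>w. isleft X (tl w)), exits = map (Cons k) (exits X) \<rparr>"

definition dunion :: "('n, 'w, 'a) circuit \<Rightarrow> ('n, 'w, 'a) circuit \<Rightarrow> ('n, 'w, 'a) circuit" where
  "dunion X Y = \<lparr> nodes = nodes X \<union> nodes Y, wires = wires X \<union> wires Y,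
                  src = (\<lambda>w. if w \<in> wires X then src X w else src Y w),
                  tgt = (\<lambda>w. if w \<in> wires X then tgt X w else tgt Y w),
                  lab = (\<lambda>w. if w \<in> wires X then lab X w else lab Y w),
                  kind = (\<lambda>n. if n \<in> nodes X then kind X n else kind Y n),
                  isleft = (\<lambda>w. if w \<in> wires X then isleft X w else isleft Y w),
                  exits = exits X @ exits Y \<rparr>"

(* add node n of kind k targeted by the wires ins (with designation), source of new wire o labelled l *)
definition add_node :: "'n \<Rightarrow> kind \<Rightarrow> ('w \<times> bool) list \<Rightarrow> 'w \<Rightarrow> 'a form
                         \<Rightarrow> ('n, 'w, 'a) circuit \<Rightarrow> ('n, 'w, 'a) circuit" where
  "add_node n k ins ow l X = X\<lparr> nodes := insert n (nodes X), wires := insert ow (wires X),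
       src := (src X)(ow := n),
       tgt := (\<lambda>w. if w \<in> fst ` set ins then Some n else tgt X w)(ow := None),
       lab := (lab X)(ow := l), kind := (kind X)(n := k),
       isleft := (\<lambda>w. case map_of ins w of Some b \<Rightarrow> b | None \<Rightarrow> isleft X w) \<rparr>"

fun trans :: "('a \<Rightarrow> 'a) \<Rightarrow> 'a mproof \<Rightarrow> (nat list, nat list, 'a) circuit" where
  "trans d (PAx P) = \<lparr> nodes = {[]}, wires = {[0], [1]}, src = (\<lambda>_. []), tgt = (\<lambda>_. None),
      lab = (\<lambda>w. if w = [0] then Lit P else Lit (d P)), kind = (\<lambda>_. KAx),
      isleft = (\<lambda>_. True), exits = [[0], [1]] \<rparr>"
| "trans d (PPerm ss p) = (let X = trans d p in X\<lparr> exits := map (\<lambda>i. exits X ! i) ss \<rparr>)"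
| "trans d (PPar p) = (let X = pref 0 (trans d p); es = exits X; n = length es;
       a = es ! (n - 2); b = es ! (n - 1) in
     (add_node [] (KBin BPar) [(a, True), (b, False)] [] (Par (lab X a) (lab X b)) X)
        \<lparr> exits := take (n - 2) es @ [[]] \<rparr>)"
| "trans d (PPlus i B p) = (let X = pref 0 (trans d p); es = exits X; a = last es in
     (add_node [] KPlus [(a, \<not> i)] [] (if i then Plus B (lab X a) else Plus (lab X a) B) X)
        \<lparr> exits := butlast es @ [[]] \<rparr>)"
| "trans d (PTens p q) = (let X = pref 0 (trans d p); Y = pref 1 (trans d q);
       a = last (exits X); b = hd (exits Y) in
     (add_node [] (KBin BTens) [(a, True), (b, False)] [] (Tens (lab X a) (lab Y b)) (dunion X Y))
        \<lparr> exits := butlast (exits X) @ [[]] @ tl (exits Y) \<rparr>)"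
| "trans d (PWith p q) = (let X = pref 0 (trans d p); Y = pref 1 (trans d q);
       n = length (exits X) - 1; a = last (exits X); b = last (exits Y);
       Z0 = add_node [] (KBin BWith) [(a, True), (b, False)] [] (With (lab X a) (lab Y b)) (dunion X Y);
       Z = fold (\<lambda>j Z. add_node [2, j] KContr [(exits X ! j, True), (exits Y ! j, False)] [2, j]
                          (lab X (exits X ! j)) Z) [0..<n] Z0 in
     Z\<lparr> exits := map (\<lambda>j. [2, j]) [0..<n] @ [[]] \<rparr>)"

definition sequentializable :: "('a \<Rightarrow> 'a) \<Rightarrow> ('n, 'w, 'a) circuit \<Rightarrow> bool" where
  "sequentializable d X \<longleftrightarrow> (\<exists>p. is_proof d p \<and> iso (trans d p) X)"

end

theory Submission
  imports Defs
begin

text \<open>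
  Readiness of a node never refers to the order of the exits or to the labels, so erasability depends
  only on the underlying graph with its node kinds, and any exit order of a sequentializable circuit
  can be reached by a final permutation rule. Both directions therefore compare circuits up to exit
  order. A translated proof is a set of new final nodes placed on top of disjoint copies of its premise
  circuits; deleting these nodes gives back the premises as connected components, so induction on the
  proof erases the circuit. Conversely, the parts of an erasure step, once sequentialized, have
  their proofs permuted so that the wires entering the deleted nodes are the active formulas, and the
  isomorphisms of the parts glue to an isomorphism from the translation of the next inference.
\<close>

text \<open>\<open>step_set\<close> acts on one shared set of circuits, in which a new part may
  coincide with a circuit already present; matching two runs member by member along an isomorphism
  would have to track such coincidences. The direction from proofs to erasure therefore uses the
  tree-shaped predicate \<open>hereditarily_erasable\<close>, which gives every part its own
  derivation and implies \<open>erasable\<close>. The other direction reads a given run backwards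
  and treats all members of the current set at once, where coincidences do no harm. The delicate
  node is \<open>&\<close>: readiness names its two components without order, and contraction nodes
  do not designate their inputs. The left input of the \<open>&\<close> node decides which component
  becomes the left premise, and each contraction input is then identified by the component it comes
  from. Since all final nodes are deleted together, a single enumeration of them orders the exits of
  both premises.\<close>

definition wf_circuit :: "('n, 'w, 'a) circuit \<Rightarrow> bool" where
  "wf_circuit X \<longleftrightarrow>
     (\<forall>w\<in>wires X. src X w \<in> nodes X \<and> (\<forall>t. tgt X w = Some t \<longrightarrow> t \<in> nodes X))"

text \<open>Reading the exits off \<open>tgt\<close> gives a set independent of the list
  \<open>exits\<close>, whose order after a deletion depends on the choice made by
  \<open>in_list\<close>.\<close>

definition exit_wires :: "('n, 'w, 'a) circuit \<Rightarrow> 'w set" where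
  "exit_wires X = {w \<in> wires X. tgt X w = None}"

definition graph_iso ::
    "('n \<Rightarrow> 'm) \<Rightarrow> ('w \<Rightarrow> 'v) \<Rightarrow> ('n, 'w, 'a) circuit \<Rightarrow> ('m, 'v, 'b) circuit \<Rightarrow> bool" where
  "graph_iso f g X Y \<longleftrightarrow> bij_betw f (nodes X) (nodes Y) \<and> bij_betw g (wires X) (wires Y)
     \<and> (\<forall>w\<in>wires X. src Y (g w) = f (src X w) \<and> tgt Y (g w) = map_option f (tgt X w))
     \<and> (\<forall>n\<in>nodes X. kind Y (f n) = kind X n)"

text \<open>Designations are compared only where they have a meaning: \<open>trans\<close> marks the
  inputs of a contraction by premise, while in an arbitrary circuit their \<open>isleft\<close>
  values are junk.\<close>

definition unordered_iso ::
    "('n \<Rightarrow> 'm) \<Rightarrow> ('w \<Rightarrow> 'v) \<Rightarrow> ('n, 'w, 'a) circuit \<Rightarrow> ('m, 'v, 'a) circuit \<Rightarrow> bool" where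
  "unordered_iso f g X Y \<longleftrightarrow> graph_iso f g X Y
     \<and> (\<forall>w\<in>wires X. lab Y (g w) = lab X w \<and> (designated X w \<longrightarrow> isleft Y (g w) = isleft X w))"

lemma iso_iff_unordered_iso:
  "iso X Y \<longleftrightarrow> (\<exists>f g. unordered_iso f g X Y \<and> exits Y = map g (exits X))"
  unfolding iso_def unordered_iso_def graph_iso_def
  by (simp add: ball_conj_distrib conj_ac)

section \<open>Reachability and connected components\<close>

lemma adjI:
  assumes "w \<in> wires X" "tgt X w = Some t"
  shows "(src X w, t) \<in> adj X" "(t, src X w) \<in> adj X"
  using assms unfolding adj_def by blast+

lemma adjE:
  assumes "(a, b) \<in> adj X"
  obtains w where "w \<in> wires X" "src X w = a" "tgt X w = Some b"
        | w where "w \<in> wires X" "src X w = b" "tgt X w = Some a"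
  using assms unfolding adj_def by blast

lemma adj_rtrancl_sym: "(a, b) \<in> (adj X)\<^sup>* \<Longrightarrow> (b, a) \<in> (adj X)\<^sup>*"
proof -
  have "sym (adj X)" unfolding sym_def by (blast elim: adjE intro: adjI)
  thus "(a, b) \<in> (adj X)\<^sup>* \<Longrightarrow> (b, a) \<in> (adj X)\<^sup>*"
    by (blast dest: sym_rtrancl symD)
qed

lemma adj_rtrancl_closed:
  assumes "(a, b) \<in> (adj X)\<^sup>*" "a \<in> C"
    and "\<And>w t. w \<in> wires X \<Longrightarrow> tgt X w = Some t \<Longrightarrow> src X w \<in> C \<longleftrightarrow> t \<in> C"
  shows "b \<in> C"
  using assms(1,2)
proof (induction rule: rtrancl_induct)
  case (step y z)
  thus ?case using assms(3) by (auto elim: adjE)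
qed auto

lemma adj_rtrancl_image:
  assumes "\<And>w t. w \<in> wires X \<Longrightarrow> tgt X w = Some t \<Longrightarrow>
      \<exists>v\<in>wires Y. src Y v = f (src X w) \<and> tgt Y v = Some (f t)"
    and "(a, b) \<in> (adj X)\<^sup>*"
  shows "(f a, f b) \<in> (adj Y)\<^sup>*"
  using assms(2)
proof (induction rule: rtrancl_induct)
  case (step y z)
  have "(f y, f z) \<in> adj Y" using step(2)
    by (elim adjE) (metis adjI assms(1))+
  thus ?case using step.IH by auto
qed auto

text \<open>A connected set of nodes that no wire enters or leaves is the reachability class of each
  of its members. Two members of \<open>CC\<close> that share a node therefore coincide, and
  covering all nodes makes \<open>CC\<close> the whole family of classes.\<close>

lemma comps_eqI:
  assumes "\<Union>CC = nodes Y" "\<And>C. C \<in> CC \<Longrightarrow> C \<noteq> {}"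
    and conn: "\<And>C n m. C \<in> CC \<Longrightarrow> n \<in> C \<Longrightarrow> m \<in> C \<Longrightarrow> (n, m) \<in> (adj Y)\<^sup>*"
    and closed: "\<And>C w t. C \<in> CC \<Longrightarrow> w \<in> wires Y \<Longrightarrow> tgt Y w = Some t \<Longrightarrow> src Y w \<in> C \<longleftrightarrow> t \<in> C"
  shows "comps Y = CC"
proof -
  have *: "{m \<in> nodes Y. (n, m) \<in> (adj Y)\<^sup>*} = C" if "C \<in> CC" "n \<in> C" for n C
  proof
    show "{m \<in> nodes Y. (n, m) \<in> (adj Y)\<^sup>*} \<subseteq> C"
      using adj_rtrancl_closed[of n _ Y C] closed[of C] that by auto
    show "C \<subseteq> {m \<in> nodes Y. (n, m) \<in> (adj Y)\<^sup>*}" using conn that assms(1) by auto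
  qed
  show ?thesis
  proof
    show "comps Y \<subseteq> CC"
    proof
      fix C assume "C \<in> comps Y"
      then obtain n where n: "n \<in> nodes Y" "C = {m \<in> nodes Y. (n, m) \<in> (adj Y)\<^sup>*}"
        unfolding comps_def by auto
      then obtain C' where "C' \<in> CC" "n \<in> C'" using assms(1) by auto
      thus "C \<in> CC" using * n by simp
    qed
    show "CC \<subseteq> comps Y"
    proof
      fix C assume C: "C \<in> CC"
      then obtain n where n: "n \<in> C" using assms(2) by blast
      have "n \<in> nodes Y" using n C assms(1) by auto
      thus "C \<in> comps Y" unfolding comps_def using *[OF C n] by blast
    qed
  qed
qed

lemma comps_nonempty: "C \<in> comps X \<Longrightarrow> C \<noteq> {}"
  unfolding comps_def by auto

lemma comps_subset: "C \<in> comps X \<Longrightarrow> C \<subseteq> nodes X"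
  unfolding comps_def by auto

lemma Union_comps: "\<Union>(comps X) = nodes X"
  unfolding comps_def by auto

lemma comps_eq_reachable:
  assumes "C \<in> comps X" "n \<in> C"
  shows "C = {m \<in> nodes X. (n, m) \<in> (adj X)\<^sup>*}"
proof -
  obtain r where r: "C = {m \<in> nodes X. (r, m) \<in> (adj X)\<^sup>*}"
    using assms(1) unfolding comps_def by auto
  hence "(r, n) \<in> (adj X)\<^sup>*" "(n, r) \<in> (adj X)\<^sup>*" using assms(2) adj_rtrancl_sym by fast+
  thus ?thesis unfolding r using rtrancl_trans[of r n "adj X"] rtrancl_trans[of n r "adj X"] by blast
qed

lemma comps_connected:
  assumes "C \<in> comps X" "n \<in> C" "m \<in> C"
  shows "(n, m) \<in> (adj X)\<^sup>*"
  using comps_eq_reachable[OF assms(1,2)] assms(3) by auto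

lemma comps_disjoint:
  assumes "C \<in> comps X" "C' \<in> comps X" "n \<in> C" "n \<in> C'"
  shows "C = C'"
  using comps_eq_reachable[OF assms(1,3)] comps_eq_reachable[OF assms(2,4)] by simp

lemma comps_closed:
  assumes "wf_circuit X" "C \<in> comps X" "w \<in> wires X" "tgt X w = Some t"
  shows "src X w \<in> C \<longleftrightarrow> t \<in> C"
proof -
  have "src X w \<in> nodes X" "t \<in> nodes X" using assms unfolding wf_circuit_def by auto
  moreover have "(src X w, t) \<in> (adj X)\<^sup>*" "(t, src X w) \<in> (adj X)\<^sup>*"
    using adjI[OF assms(3,4)] by auto
  ultimately show ?thesis using assms(2) unfolding comps_def by (auto intro: rtrancl_trans)
qed

section \<open>Deletion of nodes and restriction to a component\<close>

lemma delete_simps [simp]: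
  "nodes (delete X D) = nodes X - D"
  "wires (delete X D) = {w \<in> wires X. src X w \<notin> D}"
  "src (delete X D) = src X"
  "lab (delete X D) = lab X"
  "kind (delete X D) = kind X"
  "isleft (delete X D) = isleft X"
  "tgt (delete X D) w = (case tgt X w of None \<Rightarrow> None | Some t \<Rightarrow> if t \<in> D then None else Some t)"
  unfolding delete_def by auto

lemma restrict_simps [simp]:
  "nodes (restrict X C) = C"
  "wires (restrict X C) = {w \<in> wires X. src X w \<in> C}"
  "src (restrict X C) = src X"
  "tgt (restrict X C) = tgt X"
  "lab (restrict X C) = lab X"
  "kind (restrict X C) = kind X"
  "isleft (restrict X C) = isleft X"
  unfolding restrict_def by auto

lemma wf_delete: "wf_circuit X \<Longrightarrow> wf_circuit (delete X D)"
  unfolding wf_circuit_def by (auto split: option.splits if_splits)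

lemma wf_restrict: "wf_circuit X \<Longrightarrow> C \<in> comps X \<Longrightarrow> wf_circuit (restrict X C)"
  using comps_closed[of X C] unfolding wf_circuit_def by auto

lemma wf_parts: "wf_circuit X \<Longrightarrow> Y \<in> parts X D \<Longrightarrow> wf_circuit Y"
  unfolding parts_def by (auto intro: wf_restrict wf_delete)

section \<open>Erasability is invariant under graph isomorphism\<close>

text \<open>Each part is erased by a derivation of its own, so properties of single circuits can be
  proved by rule induction, among them transport along an isomorphism to a circuit with other node
  and wire types. Finiteness of \<open>S\<close> allows the parts to be collected into one
  \<open>step_set\<close> run.\<close>

inductive hereditarily_erasable :: "('n, 'w, 'a) circuit \<Rightarrow> bool" where
  "erase_at X N S \<Longrightarrow> finite S \<Longrightarrow> \<forall>Y\<in>S. hereditarily_erasable Y \<Longrightarrow> hereditarily_erasable X"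

text \<open>The erasable context \<open>T\<close> is what the induction needs: the parts in
  \<open>S\<close> are added to \<open>T\<close> one at a time, and the induction hypothesis for a
  part is applied with the parts added earlier as its context.\<close>

lemma hereditarily_erasable_insert:
  "hereditarily_erasable X \<Longrightarrow> step_set\<^sup>*\<^sup>* T {} \<Longrightarrow> step_set\<^sup>*\<^sup>* (insert X T) {}"
proof (induction arbitrary: T rule: hereditarily_erasable.induct)
  case (1 X N S)
  show ?case
  \<comment> \<open>A step on \<open>X\<close> requires that the rest of the set does not contain
    it; if \<open>X\<close> already lies in \<open>T\<close>, nothing has been added and no step is
    taken.\<close>
  proof (cases "X \<in> T")
    case True thus ?thesis using 1 by (simp add: insert_absorb)
  next
    case False
    have "step_set\<^sup>*\<^sup>* (T \<union> S') {}" if "S' \<subseteq> S" for S'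
      using finite_subset[OF that 1(2)] that
    proof (induction S' rule: finite_induct)
      case (insert Y S')
      thus ?case using 1(3) by auto
    qed (use 1 in auto)
    moreover have "step_set (insert X T) (T \<union> S)"
      using 1(1) False unfolding step_set_def by blast
    ultimately show ?thesis by (meson converse_rtranclp_into_rtranclp order_refl)
  qed
qed

lemma hereditarily_erasable_imp_erasable: "hereditarily_erasable X \<Longrightarrow> erasable X"
  unfolding erasable_def using hereditarily_erasable_insert[of X "{}"] by auto

lemma graph_iso_tgt:
  assumes "graph_iso f g X Y" "w \<in> wires X"
  shows "tgt Y (g w) = map_option f (tgt X w)" "src Y (g w) = f (src X w)" "g w \<in> wires Y"
  using assms unfolding graph_iso_def bij_betw_def by auto

lemma graph_iso_adj_rtrancl:
  assumes "graph_iso f g X Y" "(a, b) \<in> (adj X)\<^sup>*"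
  shows "(f a, f b) \<in> (adj Y)\<^sup>*"
  by (rule adj_rtrancl_image[of X Y, OF _ assms(2)])
    (metis graph_iso_tgt[OF assms(1)] option.simps(9))

text \<open>A path in \<open>Y\<close> is lifted wire by wire. Each of its wires is the image of a
  wire of \<open>X\<close>; well-formedness puts both ends of that wire into \<open>nodes X\<close>,
  where injectivity of \<open>f\<close> identifies one end with the node reached so far.\<close>

lemma graph_iso_adj_rtrancl_back:
  assumes iso: "graph_iso f g X Y" and wf: "wf_circuit X"
    and "a \<in> nodes X" "(f a, b') \<in> (adj Y)\<^sup>*"
  shows "\<exists>b\<in>nodes X. b' = f b \<and> (a, b) \<in> (adj X)\<^sup>*"
  using assms(4)
proof (induction rule: rtrancl_induct)
  case base thus ?case using assms(3) by auto
next
  case (step y z)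
  then obtain b where b: "b \<in> nodes X" "y = f b" "(a, b) \<in> (adj X)\<^sup>*" by auto
  have inj: "inj_on f (nodes X)" and surj: "wires Y = g ` wires X"
    using iso unfolding graph_iso_def bij_betw_def by auto
  have "\<exists>c\<in>nodes X. z = f c \<and> (b, c) \<in> adj X"
    using step(2)
  proof (cases rule: adjE)
    case (1 w)
    then obtain v where v: "v \<in> wires X" "w = g v" using surj by auto
    with 1 graph_iso_tgt[OF iso v(1)] obtain t where t: "tgt X v = Some t" "z = f t" by auto
    have "src X v = b" using 1 b v graph_iso_tgt[OF iso v(1)] wf inj
      unfolding wf_circuit_def by (metis inj_onD)
    thus ?thesis using adjI(1)[OF v(1) t(1)] t wf v unfolding wf_circuit_def by auto
  next
    case (2 w)
    then obtain v where v: "v \<in> wires X" "w = g v" using surj by auto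
    with 2 graph_iso_tgt[OF iso v(1)] obtain t where t: "tgt X v = Some t" "y = f t" by auto
    have "t = b" using b t v wf inj unfolding wf_circuit_def by (metis inj_onD)
    thus ?thesis using adjI(2)[OF v(1) t(1)] 2 v graph_iso_tgt[OF iso v(1)] wf
      unfolding wf_circuit_def by auto
  qed
  thus ?case using b by (meson rtrancl.rtrancl_into_rtrancl)
qed

lemma graph_iso_comps:
  assumes iso: "graph_iso f g X Y" and wf: "wf_circuit X"
  shows "comps Y = (`) f ` comps X"
proof -
  have N: "nodes Y = f ` nodes X" using iso unfolding graph_iso_def bij_betw_def by auto
  have "{m \<in> nodes Y. (f n, m) \<in> (adj Y)\<^sup>*} = f ` {m \<in> nodes X. (n, m) \<in> (adj X)\<^sup>*}"
    if "n \<in> nodes X" for n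
    using graph_iso_adj_rtrancl[OF iso, of n] graph_iso_adj_rtrancl_back[OF iso wf that] N
    by blast
  hence "(\<lambda>n. {m \<in> nodes Y. (n, m) \<in> (adj Y)\<^sup>*}) ` nodes Y
       = (`) f ` (\<lambda>n. {m \<in> nodes X. (n, m) \<in> (adj X)\<^sup>*}) ` nodes X"
    unfolding N image_image by (intro image_cong) auto
  thus ?thesis unfolding comps_def by (simp add: Setcompr_eq_image)
qed

lemma graph_iso_restrict:
  assumes iso: "graph_iso f g X Y" and wf: "wf_circuit X" and C: "C \<subseteq> nodes X"
  shows "graph_iso f g (restrict X C) (restrict Y (f ` C))"
proof -
  have f: "inj_on f (nodes X)" and g: "inj_on g (wires X)" "wires Y = g ` wires X"
    using iso unfolding graph_iso_def bij_betw_def by auto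
  have "src Y (g w) \<in> f ` C \<longleftrightarrow> src X w \<in> C" if "w \<in> wires X" for w
    using graph_iso_tgt[OF iso that] wf that C f unfolding wf_circuit_def
    by (metis inj_on_image_mem_iff)
  hence "g ` {w \<in> wires X. src X w \<in> C} = {w \<in> wires Y. src Y w \<in> f ` C}"
    unfolding g by auto
  moreover have "inj_on g {w \<in> wires X. src X w \<in> C}" using g(1) by (rule inj_on_subset) auto
  moreover have "inj_on f C" using f C by (rule inj_on_subset)
  ultimately show ?thesis using iso C unfolding graph_iso_def bij_betw_def by auto
qed

lemma graph_iso_delete:
  assumes iso: "graph_iso f g X Y" and wf: "wf_circuit X" and D: "D \<subseteq> nodes X"
  shows "graph_iso f g (delete X D) (delete Y (f ` D))"
proof -
  have f: "inj_on f (nodes X)" "nodes Y = f ` nodes X"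
    and g: "inj_on g (wires X)" "wires Y = g ` wires X"
    using iso unfolding graph_iso_def bij_betw_def by auto
  have mem: "f n \<in> f ` D \<longleftrightarrow> n \<in> D" if "n \<in> nodes X" for n
    using f(1) that D by (rule inj_on_image_mem_iff)
  have "src Y (g w) \<in> f ` D \<longleftrightarrow> src X w \<in> D" if "w \<in> wires X" for w
    using graph_iso_tgt[OF iso that] wf that mem unfolding wf_circuit_def by metis
  hence "g ` {w \<in> wires X. src X w \<notin> D} = {w \<in> wires Y. src Y w \<notin> f ` D}"
    unfolding g by auto
  moreover have "inj_on g {w \<in> wires X. src X w \<notin> D}" using g(1) by (rule inj_on_subset) auto
  moreover have "f ` (nodes X - D) = nodes Y - f ` D"
    unfolding f(2) by (rule inj_on_image_set_diff[OF f(1)]) (use D in auto)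
  moreover have "inj_on f (nodes X - D)" using f(1) by (rule inj_on_subset) auto
  moreover have "tgt (delete Y (f ` D)) (g w) = map_option f (tgt (delete X D) w)"
    if "w \<in> wires X" for w
    using graph_iso_tgt[OF iso that] mem wf that unfolding wf_circuit_def
    by (auto split: option.splits)
  ultimately show ?thesis using iso unfolding graph_iso_def bij_betw_def by auto
qed

lemma graph_iso_parts:
  assumes iso: "graph_iso f g X Y" and wf: "wf_circuit X" and D: "D \<subseteq> nodes X"
    and Y': "Y' \<in> parts Y (f ` D)"
  shows "\<exists>X'\<in>parts X D. graph_iso f g X' Y'"
proof -
  note del = graph_iso_delete[OF iso wf D]
  obtain C where C: "C \<in> comps (delete X D)" "Y' = restrict (delete Y (f ` D)) (f ` C)"
    using Y' unfolding parts_def graph_iso_comps[OF del wf_delete[OF wf]] by auto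
  thus ?thesis
    using graph_iso_restrict[OF del wf_delete[OF wf] comps_subset[OF C(1)]]
    unfolding parts_def by blast
qed

lemma graph_iso_final:
  assumes iso: "graph_iso f g X Y" and wf: "wf_circuit X"
  shows "{m. final Y m} = f ` {m. final X m}"
proof -
  have N: "nodes Y = f ` nodes X" and W: "wires Y = g ` wires X"
    using iso unfolding graph_iso_def bij_betw_def by auto
  show ?thesis
  proof
    show "{m. final Y m} \<subseteq> f ` {m. final X m}"
    proof
      fix m assume "m \<in> {m. final Y m}"
      then obtain w where "w \<in> wires X" "src Y (g w) = m" "tgt Y (g w) = None"
        unfolding final_def W by auto
      moreover from this have "m = f (src X w)" "tgt X w = None" "src X w \<in> nodes X"
        using graph_iso_tgt[OF iso, of w] wf unfolding wf_circuit_def by auto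
      ultimately show "m \<in> f ` {m. final X m}" unfolding final_def by auto
    qed
    show "f ` {m. final X m} \<subseteq> {m. final Y m}"
      using graph_iso_tgt[OF iso] unfolding final_def N by fastforce
  qed
qed

text \<open>Plus, tensor and par form one case because each of them deletes the node
  \<open>N\<close> alone.\<close>

lemma erase_at_cases:
  assumes "erase_at X N S"
  obtains (single) "kind X N = KPlus \<or> (kind X N = KBin BTens \<and> card (comps (delete X {N})) = 2)
        \<or> (kind X N = KBin BPar \<and> card (comps (delete X {N})) = 1)" "S = parts X {N}"
    | (amp) X1 X2 where "kind X N = KBin BWith" "\<forall>m. final X m \<and> m \<noteq> N \<longrightarrow> kind X m = KContr"
        "X1 \<noteq> X2" "comps (delete X {m. final X m}) = {X1, X2}"
        "\<forall>m. final X m \<longrightarrow> (\<exists>w1\<in>In X m. \<exists>w2\<in>In X m. src X w1 \<in> X1 \<and> src X w2 \<in> X2)"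
        "S = parts X {m. final X m}"
    | (ax) "kind X N = KAx" "nodes X = {N}" "S = {}"
  using assms unfolding erase_at_def
  by (elim conjE disjE exE)
    ((rule single, simp, assumption) | (rule amp, assumption+) | (rule ax, assumption+))+

lemma erase_at_ampI:
  assumes "final X N" "kind X N = KBin BWith" "\<And>m. final X m \<Longrightarrow> m \<noteq> N \<Longrightarrow> kind X m = KContr"
    and "X1 \<noteq> X2" "comps (delete X {m. final X m}) = {X1, X2}"
    and "\<And>m. final X m \<Longrightarrow> \<exists>w1\<in>In X m. \<exists>w2\<in>In X m. src X w1 \<in> X1 \<and> src X w2 \<in> X2"
  shows "erase_at X N (parts X {m. final X m})"
proof -
  have "\<exists>X1 X2. X1 \<noteq> X2 \<and> comps (delete X {m. final X m}) = {X1, X2} \<and>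
      (\<forall>m. final X m \<longrightarrow> (\<exists>w1\<in>In X m. \<exists>w2\<in>In X m. src X w1 \<in> X1 \<and> src X w2 \<in> X2))"
    using assms(4-6) by (intro exI[of _ X1] exI[of _ X2]) simp
  thus ?thesis using assms(1-3) unfolding erase_at_def by simp
qed

text \<open>The conclusion has the form that rule induction on \<open>hereditarily_erasable\<close>
  consumes: a finite set of parts of \<open>Y\<close>, each of which is the image of some part of
  \<open>X\<close>.\<close>

lemma graph_iso_erase_at:
  assumes iso: "graph_iso f g X Y" and wf: "wf_circuit X" and er: "erase_at X N S" "finite S"
  shows "\<exists>S'. erase_at Y (f N) S' \<and> finite S' \<and> (\<forall>Y'\<in>S'. \<exists>X'\<in>S. graph_iso f g X' Y')"
proof -
  have inj: "inj_on f (nodes X)" and NY: "nodes Y = f ` nodes X"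
    using iso unfolding graph_iso_def bij_betw_def by auto
  have fin: "final X N" and N: "N \<in> nodes X" using er unfolding erase_at_def final_def by auto
  have fin': "final Y (f N)" using graph_iso_final[OF iso wf] fin by auto
  have kind: "kind Y (f m) = kind X m" if "m \<in> nodes X" for m
    using iso that unfolding graph_iso_def by auto
  note del = graph_iso_delete[OF iso wf]
  \<comment> \<open>Components are subsets of \<open>nodes X\<close>, where \<open>f\<close> is
    injective, so taking images under \<open>f\<close> is injective on them.\<close>
  have card: "card (comps (delete Y {f N})) = card (comps (delete X {N}))"
  proof -
    have "inj_on ((`) f) (comps (delete X {N}))"
      by (rule inj_on_subset[OF inj_on_image_Pow[OF inj]]) (use comps_subset[of _ "delete X {N}"] in auto)
    thus ?thesis using graph_iso_comps[OF del[of "{N}"] wf_delete[OF wf]] N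
      by (simp add: card_image)
  qed
  have parts: "finite (parts Y (f ` D)) \<and> (\<forall>Y'\<in>parts Y (f ` D). \<exists>X'\<in>S. graph_iso f g X' Y')"
    if "D \<subseteq> nodes X" "S = parts X D" for D
  proof -
    \<comment> \<open>A restricted circuit records its node set, so distinct components give
      distinct parts; finiteness of \<open>S\<close> thus yields finiteness of the set of
      components, which then passes to \<open>Y\<close>.\<close>
    have "inj_on (restrict (delete X D)) (comps (delete X D))"
      by (rule inj_onI) (metis restrict_simps(1))
    hence "finite (comps (delete X D))"
      using that er(2) unfolding parts_def by (simp add: finite_image_iff)
    thus ?thesis using graph_iso_parts[OF iso wf that(1)] that
      unfolding parts_def graph_iso_comps[OF del[OF that(1)] wf_delete[OF wf]] by auto
  qed
  from er(1) show ?thesis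
  proof (cases rule: erase_at_cases)
    case single
    hence "erase_at Y (f N) (parts Y {f N})"
      unfolding erase_at_def using fin' card kind[OF N] by auto
    thus ?thesis using parts[of "{N}"] single N by auto
  next
    case (amp X1 X2)
    let ?F = "{m. final X m}"
    have F: "?F \<subseteq> nodes X" unfolding final_def by auto
    have FY: "{m. final Y m} = f ` ?F" by (rule graph_iso_final[OF iso wf])
    have "X1 \<subseteq> nodes X" "X2 \<subseteq> nodes X" using amp(4) comps_subset[of _ "delete X ?F"] by auto
    hence "f ` X1 \<noteq> f ` X2" using amp(3) inj by (simp add: inj_on_image_eq_iff)
    moreover have "comps (delete Y {m. final Y m}) = {f ` X1, f ` X2}"
      unfolding FY graph_iso_comps[OF del[OF F] wf_delete[OF wf]] amp(4) by auto
    moreover have "\<exists>w1\<in>In Y m. \<exists>w2\<in>In Y m. src Y w1 \<in> f ` X1 \<and> src Y w2 \<in> f ` X2"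
      if m: "final Y m" for m
    proof -
      obtain m' where m': "final X m'" "m = f m'" using FY m by auto
      then obtain w1 w2 where "w1 \<in> In X m'" "w2 \<in> In X m'" "src X w1 \<in> X1" "src X w2 \<in> X2"
        using amp(5) by blast
      hence "g w1 \<in> In Y m" "g w2 \<in> In Y m" "src Y (g w1) \<in> f ` X1" "src Y (g w2) \<in> f ` X2"
        using graph_iso_tgt[OF iso] m' unfolding In_def by auto
      thus ?thesis by blast
    qed
    moreover have "kind Y m = KContr" if m: "final Y m" "m \<noteq> f N" for m
    proof -
      obtain m' where "final X m'" "m = f m'" using FY m(1) by auto
      moreover from this have "m' \<noteq> N" "m' \<in> nodes X" using m(2) F by auto
      ultimately show ?thesis using amp(2) kind by metis
    qed
    moreover have "kind Y (f N) = KBin BWith" using amp(1) kind N by simp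
    ultimately have "erase_at Y (f N) (parts Y {m. final Y m})"
      using erase_at_ampI fin' by metis
    thus ?thesis using parts[OF F amp(6)] FY by metis
  next
    case ax
    hence "erase_at Y (f N) {}" unfolding erase_at_def using fin' kind[OF N] NY by auto
    thus ?thesis by auto
  qed
qed

lemma erase_at_wf:
  assumes "erase_at X N S" "wf_circuit X" "Y \<in> S"
  shows "wf_circuit Y"
proof -
  have "S = {} \<or> (\<exists>D. S = parts X D)" using assms(1) unfolding erase_at_def by metis
  thus ?thesis using assms(2,3) wf_parts by auto
qed

lemma hereditarily_erasable_graph_iso:
  assumes "hereditarily_erasable X" "wf_circuit X" "graph_iso f g X Y"
  shows "hereditarily_erasable Y"
  using assms
proof (induction arbitrary: Y rule: hereditarily_erasable.induct)
  case (1 X N S)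
  obtain S' where "erase_at Y (f N) S'" "finite S'" "\<forall>Y'\<in>S'. \<exists>X'\<in>S. graph_iso f g X' Y'"
    using graph_iso_erase_at[OF 1(5,4,1,2)] by auto
  moreover have "\<forall>Y'\<in>S'. hereditarily_erasable Y'"
    using 1(3) erase_at_wf[OF 1(1,4)] calculation(3) by blast
  ultimately show ?case by (blast intro: hereditarily_erasable.intros)
qed

section \<open>Circuits glued from subcircuits\<close>

text \<open>
  A translated proof consists of a renamed copy of each premise circuit \<open>T i\<close> and a set \<open>D\<close> of new
  final nodes, each of which receives at least one exit of every premise; a new node and its exit
  wire carry the same name.
\<close>

locale glued =
  fixes Z :: "(nat list, nat list, 'a) circuit" and D :: "nat list set" and I :: "nat set"
    and T :: "nat \<Rightarrow> (nat list, nat list, 'a) circuit"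
  assumes nodes_Z: "nodes Z = D \<union> (\<Union>i\<in>I. Cons i ` nodes (T i))"
    and wires_Z: "wires Z = D \<union> (\<Union>i\<in>I. Cons i ` wires (T i))"
    and fresh: "\<And>i x. i \<in> I \<Longrightarrow> i # x \<notin> D"
    and ne: "D \<noteq> {}" "I \<noteq> {}"
    and new: "\<And>x. x \<in> D \<Longrightarrow> src Z x = x \<and> tgt Z x = None"
    and kind_old: "\<And>i n. i \<in> I \<Longrightarrow> n \<in> nodes (T i) \<Longrightarrow> kind Z (i # n) = kind (T i) n"
    and old: "\<And>i w. i \<in> I \<Longrightarrow> w \<in> wires (T i) \<Longrightarrow>
        src Z (i # w) = i # src (T i) w \<and> lab Z (i # w) = lab (T i) w"
    and inner: "\<And>i w t. i \<in> I \<Longrightarrow> w \<in> wires (T i) \<Longrightarrow> tgt (T i) w = Some t \<Longrightarrow>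
        tgt Z (i # w) = Some (i # t) \<and> isleft Z (i # w) = isleft (T i) w"
    and outer: "\<And>i w t. i \<in> I \<Longrightarrow> w \<in> exit_wires (T i) \<Longrightarrow> tgt Z (i # w) = Some t \<Longrightarrow> t \<in> D"
    and attached: "\<And>i x. i \<in> I \<Longrightarrow> x \<in> D \<Longrightarrow> \<exists>w\<in>exit_wires (T i). tgt Z (i # w) = Some x"
    and wf_T: "\<And>i. i \<in> I \<Longrightarrow> wf_circuit (T i)"
    and ne_T: "\<And>i. i \<in> I \<Longrightarrow> nodes (T i) \<noteq> {}"
    and conn_T: "\<And>i. i \<in> I \<Longrightarrow> connected_circ (T i)"
begin

lemma wf_Z: "wf_circuit Z"
  unfolding wf_circuit_def
proof (intro ballI conjI allI impI)
  fix w assume w: "w \<in> wires Z"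
  thus "src Z w \<in> nodes Z" using wf_T new old unfolding wires_Z nodes_Z wf_circuit_def by fastforce
  fix t assume t: "tgt Z w = Some t"
  have "w \<notin> D" using t new by auto
  then obtain i v where v: "i \<in> I" "v \<in> wires (T i)" "w = i # v" using w wires_Z by auto
  show "t \<in> nodes Z"
  proof (cases "tgt (T i) v")
    case None
    thus ?thesis using outer[OF v(1), of v] v t unfolding nodes_Z exit_wires_def by auto
  next
    case (Some s)
    thus ?thesis using inner[OF v(1,2) Some] v t wf_T[OF v(1)]
      unfolding nodes_Z wf_circuit_def by auto
  qed
qed

lemma exit_wires_Z:
  "exit_wires Z = D \<union> (\<Union>i\<in>I. Cons i ` {w \<in> exit_wires (T i). tgt Z (i # w) = None})"
proof -
  have "tgt (T i) w = None" if "i \<in> I" "w \<in> wires (T i)" "tgt Z (i # w) = None" for i w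
    using inner[OF that(1,2)] that(3) by (cases "tgt (T i) w") auto
  thus ?thesis using new unfolding exit_wires_def wires_Z by auto
qed

text \<open>Deletion undoes the attachment: a wire of the copy that enters a new node was an exit of
  \<open>T i\<close> and becomes one again, while a wire inside the copy keeps its target, which is
  tagged and hence outside \<open>D\<close>.\<close>

lemma graph_iso_part:
  assumes "i \<in> I"
  shows "graph_iso (Cons i) (Cons i) (T i) (restrict (delete Z D) (Cons i ` nodes (T i)))"
proof -
  have "{w \<in> wires Z. src Z w \<notin> D \<and> src Z w \<in> Cons i ` nodes (T i)} = Cons i ` wires (T i)"
    using assms wf_T old new fresh unfolding wires_Z wf_circuit_def by auto
  moreover have "tgt (delete Z D) (i # w) = map_option (Cons i) (tgt (T i) w)"
    if "w \<in> wires (T i)" for w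
    using inner[OF assms that] outer[OF assms, of w] that fresh[OF assms]
    by (cases "tgt (T i) w") (auto simp: exit_wires_def split: option.splits)
  ultimately show ?thesis using kind_old old assms
    unfolding graph_iso_def bij_betw_def by (auto simp: conj_assoc)
qed

lemma comps_delete: "comps (delete Z D) = (\<lambda>i. Cons i ` nodes (T i)) ` I"
proof (rule comps_eqI)
  show "\<Union>((\<lambda>i. Cons i ` nodes (T i)) ` I) = nodes (delete Z D)"
    using fresh unfolding delete_simps nodes_Z by auto
  fix C assume "C \<in> (\<lambda>i. Cons i ` nodes (T i)) ` I"
  then obtain i where i: "i \<in> I" "C = Cons i ` nodes (T i)" by auto
  thus "C \<noteq> {}" using ne_T by auto
  note gi = graph_iso_part[OF i(1)]
  {
    fix n m assume "n \<in> C" "m \<in> C"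
    then obtain n' m' where nm: "n' \<in> nodes (T i)" "m' \<in> nodes (T i)" "n = i # n'" "m = i # m'"
      using i by auto
    have "(n', m') \<in> (adj (T i))\<^sup>*" using conn_T[OF i(1)] nm unfolding connected_circ_def by auto
    thus "(n, m) \<in> (adj (delete Z D))\<^sup>*" unfolding nm(3,4)
      by (rule adj_rtrancl_image[rotated])
        (use graph_iso_tgt[OF gi] in \<open>fastforce\<close>)
  }
  fix w t assume w: "w \<in> wires (delete Z D)" "tgt (delete Z D) w = Some t"
  have "w \<in> wires Z" "w \<notin> D" using w new by auto
  then obtain j v where v: "j \<in> I" "v \<in> wires (T j)" "w = j # v"
    unfolding wires_Z by auto
  note gj = graph_iso_tgt[OF graph_iso_part[OF v(1)] v(2)]
  have "tgt (delete Z D) w = map_option (Cons j) (tgt (T j) v)" "src Z w = j # src (T j) v"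
    using gj v by auto
  thus "src (delete Z D) w \<in> C \<longleftrightarrow> t \<in> C" using w wf_T[OF v(1)] v
    unfolding i wf_circuit_def by auto
qed

text \<open>Every new node receives a wire from every premise. Hence two new nodes are joined
  through any one premise, and two premises through any one new node.\<close>

lemma connected_Z: "connected_circ Z"
proof -
  have sub: "adj (delete Z D) \<subseteq> adj Z"
    by (auto elim!: adjE split: option.splits if_splits intro: adjI)
  have up: "(i # n, x) \<in> (adj Z)\<^sup>*" if i: "i \<in> I" "n \<in> nodes (T i)" "x \<in> D" for i n x
  proof -
    obtain w where w: "w \<in> exit_wires (T i)" "tgt Z (i # w) = Some x"
      using attached i by blast
    hence w': "w \<in> wires (T i)" "src (T i) w \<in> nodes (T i)"
      using wf_T[OF i(1)] unfolding exit_wires_def wf_circuit_def by auto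
    have "(i # n, i # src (T i) w) \<in> (adj (delete Z D))\<^sup>*"
      by (rule comps_connected[where C = "Cons i ` nodes (T i)"])
        (use comps_delete i w' in auto)
    hence "(i # n, i # src (T i) w) \<in> (adj Z)\<^sup>*" using rtrancl_mono[OF sub] by auto
    moreover have "i # w \<in> wires Z" using w' i unfolding wires_Z by auto
    hence "(i # src (T i) w, x) \<in> adj Z"
      using adjI(1)[of "i # w" Z x] w old[OF i(1) w'(1)] by auto
    ultimately show ?thesis by simp
  qed
  obtain x0 i0 where x0: "x0 \<in> D" "i0 \<in> I" using ne by auto
  obtain n0 where n0: "n0 \<in> nodes (T i0)" using ne_T x0 by blast
  have "(n, x0) \<in> (adj Z)\<^sup>*" if "n \<in> nodes Z" for n
  proof (cases "n \<in> D")
    case True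
    show ?thesis
      by (rule rtrancl_trans[OF adj_rtrancl_sym[OF up[OF x0(2) n0 True]] up[OF x0(2) n0 x0(1)]])
  next
    case False
    thus ?thesis using that up x0 unfolding nodes_Z by auto
  qed
  thus ?thesis unfolding connected_circ_def by (meson adj_rtrancl_sym rtrancl_trans)
qed

lemma parts_erasable:
  assumes "\<And>i. i \<in> I \<Longrightarrow> hereditarily_erasable (T i)" "Y \<in> parts Z D"
  shows "hereditarily_erasable Y"
proof -
  obtain i where "i \<in> I" "Y = restrict (delete Z D) (Cons i ` nodes (T i))"
    using assms(2) unfolding parts_def comps_delete by auto
  thus ?thesis
    using hereditarily_erasable_graph_iso[OF assms(1) wf_T graph_iso_part] by simp
qed

lemma finite_parts: "finite I \<Longrightarrow> finite (parts Z D)"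
  unfolding parts_def comps_delete by simp

lemma final_new: "x \<in> D \<Longrightarrow> final Z x"
  using new unfolding final_def nodes_Z wires_Z by auto

end

section \<open>The shape of translated proofs\<close>

text \<open>The invariant for the induction on proofs. Its last clause identifies the list
  manipulated by \<open>trans\<close> with the actual exits, so entries of that list can be used as
  untargeted wires.\<close>

definition trans_inv :: "('n, 'w, 'a) circuit \<Rightarrow> bool" where
  "trans_inv X \<longleftrightarrow> wf_circuit X \<and> nodes X \<noteq> {} \<and> connected_circ X
     \<and> distinct (exits X) \<and> set (exits X) = exit_wires X"

text \<open>This lemma and its analogues for plus, tensor and with are the interface to
  \<open>trans\<close>: later arguments about these four rules refer to the \<open>glued\<close>
  structure and the listed values instead of unfolding the translation. Writing the exits as
  \<open>es @ [a, b]\<close> gives names to the active ones.\<close>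

lemma trans_Par:
  fixes d p
  defines "T \<equiv> trans d p" and "Z \<equiv> trans d (PPar p)"
  assumes inv: "trans_inv T" and ex: "exits T = es @ [a, b]"
  shows "glued Z {[]} {0} (\<lambda>_. T)"
    and "exits Z = map (Cons 0) es @ [[]]"
    and "kind Z [] = KBin BPar" "lab Z [] = Par (lab T a) (lab T b)"
    and "tgt Z (0 # w) = (if w \<in> {a, b} then Some [] else map_option (Cons 0) (tgt T w))"
    and "isleft Z (0 # a)" "\<not> isleft Z (0 # b)"
proof -
  have ab: "a \<in> exit_wires T" "b \<in> exit_wires T" "a \<noteq> b"
    using inv ex unfolding trans_inv_def by auto
  note defs = Z_def T_def[symmetric] Let_def pref_def add_node_def ex nth_append
  show "exits Z = map (Cons 0) es @ [[]]" "kind Z [] = KBin BPar" "lab Z [] = Par (lab T a) (lab T b)"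
    "isleft Z (0 # a)" "\<not> isleft Z (0 # b)"
    using ab by (simp_all add: defs)
  show "tgt Z (0 # w) = (if w \<in> {a, b} then Some [] else map_option (Cons 0) (tgt T w))" for w
    by (simp add: defs)
  show "glued Z {[]} {0} (\<lambda>_. T)"
    using inv ab unfolding trans_inv_def exit_wires_def
    by unfold_locales (auto simp: defs exit_wires_def split: if_splits)
qed

lemma trans_Plus:
  fixes d p i B
  defines "T \<equiv> trans d p" and "Z \<equiv> trans d (PPlus i B p)"
  assumes inv: "trans_inv T" and ex: "exits T = es @ [a]"
  shows "glued Z {[]} {0} (\<lambda>_. T)"
    and "exits Z = map (Cons 0) es @ [[]]"
    and "kind Z [] = KPlus" "lab Z [] = (if i then Plus B (lab T a) else Plus (lab T a) B)"
    and "tgt Z (0 # w) = (if w = a then Some [] else map_option (Cons 0) (tgt T w))"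
    and "isleft Z (0 # a) \<longleftrightarrow> \<not> i"
proof -
  have a: "a \<in> exit_wires T"
    using inv ex unfolding trans_inv_def by auto
  note defs = Z_def T_def[symmetric] Let_def pref_def add_node_def ex nth_append
  show "exits Z = map (Cons 0) es @ [[]]" "kind Z [] = KPlus"
    "lab Z [] = (if i then Plus B (lab T a) else Plus (lab T a) B)"
    "isleft Z (0 # a) \<longleftrightarrow> \<not> i"
    using a by (simp_all add: defs)
  show "tgt Z (0 # w) = (if w = a then Some [] else map_option (Cons 0) (tgt T w))" for w
    by (simp add: defs)
  show "glued Z {[]} {0} (\<lambda>_. T)"
    using inv a unfolding trans_inv_def exit_wires_def
    by unfold_locales (auto simp: defs exit_wires_def split: if_splits)
qed

text \<open>The two premises are passed as one family \<open>T\<close>, as \<open>glued\<close>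
  expects; the second index is written \<open>Suc 0\<close> because the simplifier rewrites
  \<open>1\<close> to it.\<close>

lemma trans_Tens:
  fixes d p q and T :: "nat \<Rightarrow> (nat list, nat list, 'a) circuit"
  defines "Z \<equiv> trans d (PTens p q)"
  assumes T: "trans d p = T 0" "trans d q = T (Suc 0)"
    and inv: "trans_inv (T 0)" "trans_inv (T (Suc 0))"
    and ex: "exits (T 0) = es @ [a]" "exits (T (Suc 0)) = b # fs"
  shows "glued Z {[]} {0, Suc 0} T"
    and "exits Z = map (Cons 0) es @ [[]] @ map (Cons (Suc 0)) fs"
    and "kind Z [] = KBin BTens" "lab Z [] = Tens (lab (T 0) a) (lab (T (Suc 0)) b)"
    and "v \<in> wires (T 0) \<Longrightarrow>
      tgt Z (0 # v) = (if v = a then Some [] else map_option (Cons 0) (tgt (T 0) v))"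
    and "w \<in> wires (T (Suc 0)) \<Longrightarrow>
      tgt Z (Suc 0 # w) = (if w = b then Some [] else map_option (Cons (Suc 0)) (tgt (T (Suc 0)) w))"
    and "isleft Z (0 # a)" "\<not> isleft Z (Suc 0 # b)"
proof -
  have ab: "a \<in> exit_wires (T 0)" "b \<in> exit_wires (T (Suc 0))"
    using inv ex unfolding trans_inv_def by auto
  note defs = Z_def T Let_def pref_def add_node_def dunion_def ex nth_append
  show "exits Z = map (Cons 0) es @ [[]] @ map (Cons (Suc 0)) fs" "kind Z [] = KBin BTens"
    "lab Z [] = Tens (lab (T 0) a) (lab (T (Suc 0)) b)"
    "isleft Z (0 # a)" "\<not> isleft Z (Suc 0 # b)"
    by (simp_all add: defs)
  show "tgt Z (0 # v) = (if v = a then Some [] else map_option (Cons 0) (tgt (T 0) v))"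
    if "v \<in> wires (T 0)" for v
    using that by (auto simp add: defs)
  show "tgt Z (Suc 0 # w) = (if w = b then Some [] else map_option (Cons (Suc 0)) (tgt (T (Suc 0)) w))"
    if "w \<in> wires (T (Suc 0))" for w
    using that by (auto simp add: defs)
  show "glued Z {[]} {0, Suc 0} T"
    using inv ab unfolding trans_inv_def exit_wires_def
    by unfold_locales (auto simp: defs exit_wires_def split: if_splits)
qed

text \<open>Loop invariant of the \<open>fold\<close> that creates the contraction nodes.
  Distinctness of the inputs keeps a round from redirecting a wire attached earlier, and
  \<open>fresh\<close> keeps it from giving a target to a new exit. The designations of the
  contraction inputs are left open, as they carry no meaning.\<close>

lemma fold_add_contr:
  fixes a b :: "nat \<Rightarrow> nat list" and Z0 :: "(nat list, nat list, 'a) circuit" and l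
  defines "W \<equiv> \<lambda>k. fold (\<lambda>j Z. add_node [2, j] KContr [(a j, True), (b j, False)] [2, j] (l j) Z)
      [0..<k] Z0"
  assumes "k \<le> n" and inj: "inj_on a {..<n}" "inj_on b {..<n}"
    and ab: "\<And>i j. i < n \<Longrightarrow> j < n \<Longrightarrow> a i \<noteq> b j"
    and fresh: "\<And>i j. i < n \<Longrightarrow> a i \<noteq> [2, j] \<and> b i \<noteq> [2, j]"
  shows "nodes (W k) = nodes Z0 \<union> (\<lambda>j. [2, j]) ` {..<k}
    \<and> wires (W k) = wires Z0 \<union> (\<lambda>j. [2, j]) ` {..<k}
    \<and> (\<forall>j<k. src (W k) [2, j] = [2, j] \<and> tgt (W k) [2, j] = None \<and> lab (W k) [2, j] = l j
          \<and> kind (W k) [2, j] = KContr)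
    \<and> (\<forall>x. (\<forall>j<k. x \<noteq> [2, j]) \<longrightarrow>
          src (W k) x = src Z0 x \<and> lab (W k) x = lab Z0 x \<and> kind (W k) x = kind Z0 x)
    \<and> (\<forall>j<k. tgt (W k) (a j) = Some [2, j] \<and> tgt (W k) (b j) = Some [2, j])
    \<and> (\<forall>x. (\<forall>j<k. x \<noteq> [2, j] \<and> x \<noteq> a j \<and> x \<noteq> b j) \<longrightarrow>
          tgt (W k) x = tgt Z0 x \<and> isleft (W k) x = isleft Z0 x)"
  using \<open>k \<le> n\<close>
proof (induction k)
  case 0
  show ?case by (simp add: W_def)
next
  case (Suc k)
  have W: "W (Suc k) = add_node [2, k] KContr [(a k, True), (b k, False)] [2, k] (l k) (W k)"
    by (simp add: W_def)
  have k: "k < n" using Suc by simp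
  have neq: "a j \<noteq> a k" "b j \<noteq> b k" "a j \<noteq> b k" "b j \<noteq> a k" "[2, j] \<noteq> a k" "[2, j] \<noteq> b k"
    if "j < k" for j
    using that k inj ab[of j k] ab[of k j] fresh[of k j] by (auto dest: inj_onD)
  have neq': "a k \<noteq> [2, k]" "b k \<noteq> [2, k]" "a k \<noteq> b k" "a j \<noteq> [2, k] " "b j \<noteq> [2, k]" if "j \<le> k" for j
    using k that fresh[of k k] fresh[of j k] ab[of k k] by auto
  show ?case using Suc.IH k neq neq'
    by (auto simp: W add_node_def less_Suc_eq lessThan_Suc)
qed

lemma trans_With:
  fixes d p q and T :: "nat \<Rightarrow> (nat list, nat list, 'a) circuit"
  defines "Z \<equiv> trans d (PWith p q)"
  assumes T: "trans d p = T 0" "trans d q = T (Suc 0)"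
    and inv: "trans_inv (T 0)" "trans_inv (T (Suc 0))"
    and ex: "exits (T 0) = es @ [a]" "exits (T (Suc 0)) = fs @ [b]" "length fs = length es"
  shows "glued Z (insert [] ((\<lambda>j. [2, j]) ` {..<length es})) {0, Suc 0} T"
    and "exits Z = map (\<lambda>j. [2, j]) [0..<length es] @ [[]]"
    and "kind Z [] = KBin BWith" "lab Z [] = With (lab (T 0) a) (lab (T (Suc 0)) b)"
    and "\<And>j. j < length es \<Longrightarrow> kind Z [2, j] = KContr \<and> lab Z [2, j] = lab (T 0) (es ! j)"
    and "tgt Z (0 # a) = Some []" "tgt Z (Suc 0 # b) = Some []"
    and "\<And>j. j < length es \<Longrightarrow> tgt Z (0 # es ! j) = Some [2, j] \<and> tgt Z (Suc 0 # fs ! j) = Some [2, j]"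
    and "isleft Z (0 # a)" "\<not> isleft Z (Suc 0 # b)"
proof -
  let ?n = "length es"
  have dist: "distinct (es @ [a])" "distinct (fs @ [b])"
    and exw: "exit_wires (T 0) = set (es @ [a])" "exit_wires (T (Suc 0)) = set (fs @ [b])"
    using inv ex unfolding trans_inv_def by auto
  have ab: "a \<in> exit_wires (T 0)" "b \<in> exit_wires (T (Suc 0))"
    using exw by auto
  define X Y where "X = pref 0 (T 0)" and "Y = pref (Suc 0) (T (Suc 0))"
  have eX: "exits X = map (Cons 0) (es @ [a])" and eY: "exits Y = map (Cons (Suc 0)) (fs @ [b])"
    by (simp_all add: X_def Y_def pref_def ex)
  define Z0 where "Z0 = add_node [] (KBin BWith) [(0 # a, True), (Suc 0 # b, False)] []
      (With (lab (T 0) a) (lab (T (Suc 0)) b)) (dunion X Y)"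
  define W where "W = fold (\<lambda>j Z. add_node [2, j] KContr [(exits X ! j, True), (exits Y ! j, False)] [2, j]
                          (lab X (exits X ! j)) Z) [0..<?n] Z0"
  have Z: "Z = W\<lparr>exits := map (\<lambda>j. [2, j]) [0..<?n] @ [[]]\<rparr>"
    unfolding Z_def W_def Z0_def by (simp add: Let_def T X_def Y_def pref_def ex)
  have nX: "exits X ! j = 0 # es ! j" "exits Y ! j = Suc 0 # fs ! j" if "j < ?n" for j
    using that ex(3) unfolding eX eY by (simp_all add: nth_append)
  have "inj_on ((!) (exits X)) {..<?n}" "inj_on ((!) (exits Y)) {..<?n}"
    using dist ex(3) by (auto simp: inj_on_def nX nth_eq_iff_index_eq)
  note F = fold_add_contr[of ?n ?n "(!) (exits X)" "(!) (exits Y)" "\<lambda>j. lab X (exits X ! j)" Z0,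
      OF order_refl this, folded W_def]
  \<comment> \<open>The side conditions that \<open>F\<close> still carries, disjointness of the two
    input families and freshness of the names \<open>[2, j]\<close>, are discharged by the leading
    tags 0, 1 and 2.\<close>
  have F: "nodes W = nodes Z0 \<union> (\<lambda>j. [2, j]) ` {..<?n}"
    "wires W = wires Z0 \<union> (\<lambda>j. [2, j]) ` {..<?n}"
    "\<And>j. j < ?n \<Longrightarrow> src W [2, j] = [2, j] \<and> tgt W [2, j] = None \<and> lab W [2, j] = lab (T 0) (es ! j)
          \<and> kind W [2, j] = KContr"
    "\<And>x. (\<forall>j<?n. x \<noteq> [2, j]) \<Longrightarrow>
          src W x = src Z0 x \<and> lab W x = lab Z0 x \<and> kind W x = kind Z0 x"
    "\<And>j. j < ?n \<Longrightarrow> tgt W (0 # es ! j) = Some [2, j] \<and> tgt W (Suc 0 # fs ! j) = Some [2, j]"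
    "\<And>x. (\<forall>j<?n. x \<noteq> [2, j] \<and> x \<noteq> 0 # es ! j \<and> x \<noteq> Suc 0 # fs ! j) \<Longrightarrow>
          tgt W x = tgt Z0 x \<and> isleft W x = isleft Z0 x"
    using F by (simp_all add: nX) (simp add: X_def pref_def)
  note defs = Z0_def X_def Y_def Let_def pref_def add_node_def dunion_def
  have neq: "a \<noteq> es ! j" "b \<noteq> fs ! j" if "j < ?n" for j
    using dist that ex(3) by (metis distinct_append not_distinct_conv_prefix nth_mem nth_append_length
      disjoint_insert(1) list.simps(15))+
  have a: "tgt W (0 # a) = Some []" "isleft W (0 # a)" "tgt W (Suc 0 # b) = Some []"
    "\<not> isleft W (Suc 0 # b)"
    using F(6)[of "0 # a"] F(6)[of "Suc 0 # b"] neq by (auto simp: defs)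
  show "exits Z = map (\<lambda>j. [2, j]) [0..<length es] @ [[]]"
    "kind Z [] = KBin BWith" "lab Z [] = With (lab (T 0) a) (lab (T (Suc 0)) b)"
    using F(4)[of "[]"] by (simp_all add: Z) (simp_all add: defs)
  show contr: "\<And>j. j < length es \<Longrightarrow> kind Z [2, j] = KContr \<and> lab Z [2, j] = lab (T 0) (es ! j)"
    "tgt Z (0 # a) = Some []" "tgt Z (Suc 0 # b) = Some []"
    and tg: "\<And>j. j < length es \<Longrightarrow> tgt Z (0 # es ! j) = Some [2, j] \<and> tgt Z (Suc 0 # fs ! j) = Some [2, j]"
    and "isleft Z (0 # a)" "\<not> isleft Z (Suc 0 # b)"
    using F(3,5) a by (simp_all add: Z)
  have ZW: "nodes Z = nodes W" "wires Z = wires W" "src Z = src W" "tgt Z = tgt W" "lab Z = lab W"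
    "kind Z = kind W" "isleft Z = isleft W" by (simp_all add: Z)
  let ?D = "insert [] ((\<lambda>j. [2, j]) ` {..<length es})"
  \<comment> \<open>In a with rule no exit of a premise survives: the last one enters the with node,
    each other one a contraction.\<close>
  have exits_tgt: "tgt Z (i # w) \<in> Some ` ?D" if "i \<in> {0, Suc 0}" "w \<in> exit_wires (T i)" for i w
    using that tg contr(2,3) ex(3) unfolding ZW by (auto simp: exw in_set_conv_nth) 
  show "glued Z ?D {0, Suc 0} T"
  proof
    show "nodes Z = ?D \<union> (\<Union>i\<in>{0, Suc 0}. Cons i ` nodes (T i))"
      "wires Z = ?D \<union> (\<Union>i\<in>{0, Suc 0}. Cons i ` wires (T i))"
      unfolding ZW F(1,2) by (auto simp: defs)
    show "i # x \<notin> ?D" if "i \<in> {0, Suc 0}" for i x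
      using that by auto
    show "src Z x = x \<and> tgt Z x = None" if "x \<in> ?D" for x
      using that F(3) F(4)[of "[]"] F(6)[of "[]"] unfolding ZW by (auto simp: defs)
    fix i :: nat assume i: "i \<in> {0, Suc 0}"
    show "kind Z (i # n) = kind (T i) n" if "n \<in> nodes (T i)" for n
      using i that F(4)[of "i # n"] unfolding ZW by (auto simp: defs)
    show "src Z (i # w) = i # src (T i) w \<and> lab Z (i # w) = lab (T i) w" if "w \<in> wires (T i)" for w
      using i that F(4)[of "i # w"] unfolding ZW by (auto simp: defs)
    show "tgt Z (i # w) = Some (i # t) \<and> isleft Z (i # w) = isleft (T i) w"
      if w: "w \<in> wires (T i)" "tgt (T i) w = Some t" for w t
    proof -
      have "w \<notin> exit_wires (T i)" using w by (simp add: exit_wires_def)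
      hence "tgt W (i # w) = tgt Z0 (i # w) \<and> isleft W (i # w) = isleft Z0 (i # w)"
        and "i = 0 \<longrightarrow> w \<noteq> a" "i = Suc 0 \<longrightarrow> w \<noteq> b"
        using i ex(3) by (auto intro!: F(6) simp: exw)
      thus ?thesis using i w unfolding ZW by (auto simp: defs)
    qed
    show "t \<in> ?D" if "w \<in> exit_wires (T i)" "tgt Z (i # w) = Some t" for w t
      using exits_tgt[OF i that(1)] that(2) by auto
    show "\<exists>w\<in>exit_wires (T i). tgt Z (i # w) = Some x" if "x \<in> ?D" for x
      using i that tg contr(2,3) ex(3) by (fastforce simp: exw)
    show "wf_circuit (T i)" "nodes (T i) \<noteq> {}" "connected_circ (T i)"
      using i inv unfolding trans_inv_def by auto
  qed auto
qed

declare trans.simps [simp del]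

lemma trans_inv_glued:
  assumes "glued Z D I T" "distinct (exits Z)"
    and "set (exits Z) = D \<union> (\<Union>i\<in>I. Cons i ` {w \<in> exit_wires (T i). tgt Z (i # w) = None})"
  shows "trans_inv Z"
  using assms glued.wf_Z[OF assms(1)] glued.connected_Z[OF assms(1)] glued.exit_wires_Z[OF assms(1)]
    glued.nodes_Z[OF assms(1)] glued.ne[OF assms(1)]
  unfolding trans_inv_def by auto

lemma list_split_last: "xs \<noteq> [] \<Longrightarrow> \<exists>ys x. xs = ys @ [x]"
  by (metis append_butlast_last_id)

lemma list_split_last2:
  assumes "2 \<le> length xs"
  shows "\<exists>ys a b. xs = ys @ [a, b]"
proof -
  obtain zs b where "xs = zs @ [b]" "zs \<noteq> []" using list_split_last[of xs] assms by force
  thus ?thesis using list_split_last[of zs] by auto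
qed

text \<open>Both claims go through one induction because they depend on each other: the side
  conditions of a rule speak of the formula list \<open>G\<close>, and its equality with the list of
  exit labels turns them into the shape of \<open>exits\<close> that the gluing lemmas
  require.\<close>

lemma trans_inv_trans:
  "concl d p = Some G \<Longrightarrow> trans_inv (trans d p) \<and> G = map (lab (trans d p)) (exits (trans d p))"
proof (induction p arbitrary: G)
  case (PAx P)
  show ?case using PAx
    by (auto simp: trans.simps trans_inv_def wf_circuit_def connected_circ_def exit_wires_def)
next
  case (PPerm ss p)
  let ?T = "trans d p"
  obtain H where H: "concl d p = Some H" "distinct ss" "set ss = {..<length H}" "G = map ((!) H) ss"
    using PPerm.prems by (auto split: option.splits if_splits)
  note IH = PPerm.IH[OF H(1)]
  have len: "length H = length (exits ?T)" using IH by simp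
  have "distinct (exits ?T)" using IH unfolding trans_inv_def by simp
  hence "distinct (map ((!) (exits ?T)) ss)"
    using H(2,3) len by (auto simp: distinct_map inj_on_def nth_eq_iff_index_eq)
  moreover have "set (map ((!) (exits ?T)) ss) = set (exits ?T)"
    using H(3) len by (simp add: atLeast0LessThan[symmetric] nth_image)
  moreover have "G = map (lab ?T) (map ((!) (exits ?T)) ss)"
    using IH H by auto
  ultimately show ?case using IH
    by (simp add: trans.simps trans_inv_def wf_circuit_def connected_circ_def exit_wires_def adj_def Let_def)
next
  case (PPar p)
  let ?T = "trans d p"
  obtain H where H: "concl d p = Some H" "2 \<le> length H"
    "G = take (length H - 2) H @ [Par (H ! (length H - 2)) (H ! (length H - 1))]"
    using PPar.prems by (auto split: option.splits if_splits)
  note IH = PPar.IH[OF H(1)]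
  obtain es a b where ex: "exits ?T = es @ [a, b]"
    using list_split_last2[of "exits ?T"] H(2) IH by auto
  note Z = trans_Par[OF conjunct1[OF IH] ex]
  have T: "distinct (exits ?T)" "exit_wires ?T = set (exits ?T)"
    using IH unfolding trans_inv_def by auto
  have none: "tgt ?T w = None" if "w \<in> set (exits ?T)" for w
    using that T unfolding exit_wires_def by auto
  have "trans_inv (trans d (PPar p))"
    by (rule trans_inv_glued[OF Z(1)], unfold Z(2)) (use T none in \<open>auto simp: ex distinct_map Z(5)\<close>)
  moreover have "lab (trans d (PPar p)) (0 # w) = lab ?T w" if "w \<in> set es" for w
    using glued.old[OF Z(1), of 0 w] that T unfolding exit_wires_def ex by auto
  ultimately show ?case using H(3) IH unfolding Z(2)
    by (simp add: Z(4) ex nth_append)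
next
  case (PPlus i B p)
  let ?T = "trans d p"
  obtain H where H: "concl d p = Some H" "H \<noteq> []"
    "G = butlast H @ [if i then Plus B (last H) else Plus (last H) B]"
    using PPlus.prems by (auto split: option.splits if_splits)
  note IH = PPlus.IH[OF H(1)]
  obtain es a where ex: "exits ?T = es @ [a]"
    using IH H(2) list_split_last[of "exits ?T"] by auto
  note Z = trans_Plus[OF conjunct1[OF IH] ex, of i B]
  have T: "distinct (exits ?T)" "exit_wires ?T = set (exits ?T)"
    using IH unfolding trans_inv_def by auto
  have none: "tgt ?T w = None" if "w \<in> set (exits ?T)" for w
    using that T unfolding exit_wires_def by auto
  have "trans_inv (trans d (PPlus i B p))"
    by (rule trans_inv_glued[OF Z(1)], unfold Z(2)) (use T none in \<open>auto simp: ex distinct_map Z(5)\<close>)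
  moreover have "lab (trans d (PPlus i B p)) (0 # w) = lab ?T w" if "w \<in> set es" for w
    using glued.old[OF Z(1), of 0 w] that T unfolding exit_wires_def ex by auto
  ultimately show ?case using H(3) IH unfolding Z(2)
    by (simp add: Z(4) ex)
next
  case (PTens p q)
  define T where "T = (\<lambda>i::nat. trans d (if i = 0 then p else q))"
  hence T01: "trans d p = T 0" "trans d q = T (Suc 0)" by simp_all
  obtain H K where H: "concl d p = Some H" "concl d q = Some K" "H \<noteq> []" "K \<noteq> []"
    "G = butlast H @ [Tens (last H) (hd K)] @ tl K"
    using PTens.prems by (auto split: option.splits if_splits)
  have IH: "trans_inv (T 0)" "H = map (lab (T 0)) (exits (T 0))"
     "trans_inv (T (Suc 0))" "K = map (lab (T (Suc 0))) (exits (T (Suc 0)))"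
    using PTens.IH(1)[OF H(1)] PTens.IH(2)[OF H(2)] by (auto simp: T_def)
  obtain es a where ex: "exits (T 0) = es @ [a]"
    using IH H(3) list_split_last[of "exits (T 0)"] by auto
  obtain fs b where ex': "exits (T (Suc 0)) = b # fs"
    using IH H(4) by (cases "exits (T (Suc 0))") auto
  note Z = trans_Tens[of d p T q, OF T01 IH(1,3) ex ex']
  have T: "distinct (exits (T 0))" "exit_wires (T 0) = set (exits (T 0))"
    "distinct (exits (T (Suc 0)))" "exit_wires (T (Suc 0)) = set (exits (T (Suc 0)))"
    using IH unfolding trans_inv_def by auto
  have none: "w \<in> wires (T i)" "tgt (T i) w = None" if "w \<in> set (exits (T i))" "i = 0 \<or> i = Suc 0" for i w
    using that T unfolding exit_wires_def by auto
  have "trans_inv (trans d (PTens p q))"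
    by (rule trans_inv_glued[OF Z(1)], unfold Z(2))
      (use T Z(5,6) none[of _ 0] none[of _ "Suc 0"] in \<open>auto simp: ex ex' distinct_map\<close>)
  moreover have "lab (trans d (PTens p q)) (0 # w) = lab (T 0) w" if "w \<in> set es" for w
    using glued.old[OF Z(1), of 0 w] that none[of w 0] unfolding ex by auto
  moreover have "lab (trans d (PTens p q)) (Suc 0 # w) = lab (T (Suc 0)) w" if "w \<in> set fs" for w
    using glued.old[OF Z(1), of "Suc 0" w] that none[of w "Suc 0"] unfolding ex' by auto
  ultimately show ?case using H(5) IH unfolding Z(2)
    by (simp add: Z(4) ex ex')
next
  case (PWith p q)
  define T where "T = (\<lambda>i::nat. trans d (if i = 0 then p else q))"
  hence T01: "trans d p = T 0" "trans d q = T (Suc 0)" by simp_all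
  obtain H K where H: "concl d p = Some H" "concl d q = Some K" "H \<noteq> []" "K \<noteq> []"
    "butlast H = butlast K" "G = butlast H @ [With (last H) (last K)]"
    using PWith.prems by (auto split: option.splits if_splits)
  have IH: "trans_inv (T 0)" "H = map (lab (T 0)) (exits (T 0))"
     "trans_inv (T (Suc 0))" "K = map (lab (T (Suc 0))) (exits (T (Suc 0)))"
    using PWith.IH(1)[OF H(1)] PWith.IH(2)[OF H(2)] by (auto simp: T_def)
  obtain es a where ex: "exits (T 0) = es @ [a]"
    using IH H(3) list_split_last[of "exits (T 0)"] by auto
  obtain fs b where ex': "exits (T (Suc 0)) = fs @ [b]"
    using IH H(4) list_split_last[of "exits (T (Suc 0))"] by auto
  \<comment> \<open>The rule demands equal contexts in both premises, which makes the numbers of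
    contraction inputs agree.\<close>
  have len: "length fs = length es" using arg_cong[OF H(5), of length] IH ex ex' by simp
  note Z = trans_With[of d p T q, OF T01 IH(1,3) ex ex' len]
  have T: "exit_wires (T 0) = set (exits (T 0))"
    "exit_wires (T (Suc 0)) = set (exits (T (Suc 0)))"
    using IH unfolding trans_inv_def by auto
  \<comment> \<open>All exits of both premises are consumed, so only the new wires remain as
    exits.\<close>
  have "{w \<in> exit_wires (T i). tgt (trans d (PWith p q)) (i # w) = None} = {}"
    if "i \<in> {0, Suc 0}" for i
    using that Z(6-8) T len
    by (auto simp: ex ex' in_set_conv_nth)
  hence "trans_inv (trans d (PWith p q))"
    by (intro trans_inv_glued[OF Z(1)], unfold Z(2))
      (auto simp: distinct_map inj_on_def simp del: Collect_empty_eq)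
  moreover have "map (\<lambda>j. lab (trans d (PWith p q)) [2, j]) [0..<length es] = map (lab (T 0)) es"
    using Z(5) by (intro nth_equalityI) simp_all
  ultimately show ?case using H(6) IH unfolding Z(2)
    by (simp add: Z(4) ex ex' comp_def)
qed

section \<open>Translated proofs are erasable\<close>

lemma concl_exits:
  assumes "concl d p = Some G"
  shows "trans_inv (trans d p)" "G = map (lab (trans d p)) (exits (trans d p))"
    "length (exits (trans d p)) = length G" "exits (trans d p) = [] \<longleftrightarrow> G = []"
  using trans_inv_trans[OF assms] by auto

lemma trans_hereditarily_erasable:
  "concl d p = Some G \<Longrightarrow> hereditarily_erasable (trans d p)"
proof (induction p arbitrary: G)
  case (PAx P)
  have "erase_at (trans d (PAx P)) [] {}" by (auto simp: trans.simps erase_at_def final_def)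
  thus ?case by (rule hereditarily_erasable.intros) auto
next
  case (PPerm ss p)
  then obtain H where H: "concl d p = Some H" by (auto split: option.splits)
  \<comment> \<open>A permutation changes only the field \<open>exits\<close>, to which
    \<open>graph_iso\<close> is blind.\<close>
  have "graph_iso id id (trans d p) (trans d (PPerm ss p))"
    by (simp add: trans.simps graph_iso_def Let_def option.map_id)
  thus ?case using hereditarily_erasable_graph_iso PPerm.IH[OF H] concl_exits(1)[OF H]
    unfolding trans_inv_def by blast
next
  case (PPar p)
  let ?T = "trans d p" and ?Z = "trans d (PPar p)"
  obtain H where H: "concl d p = Some H" "2 \<le> length H"
    using PPar.prems by (auto split: option.splits if_splits)
  note E = concl_exits[OF H(1)]
  obtain es a b where ex: "exits ?T = es @ [a, b]"
    using list_split_last2[of "exits ?T"] H(2) E(3) by auto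
  note Z = trans_Par[OF E(1) ex]
  interpret glued ?Z "{[]}" "{0}" "\<lambda>_. ?T" by (rule Z(1))
  \<comment> \<open>With a single premise index, \<open>comps_delete\<close> leaves one component,
    which is the readiness condition of a par node.\<close>
  have "erase_at ?Z [] (parts ?Z {[]})"
    using final_new[of "[]"] Z(3) unfolding erase_at_def comps_delete by simp
  thus ?case using parts_erasable PPar.IH[OF H(1)] finite_parts
    by (blast intro: hereditarily_erasable.intros)
next
  case (PPlus i B p)
  let ?T = "trans d p" and ?Z = "trans d (PPlus i B p)"
  obtain H where H: "concl d p = Some H" "H \<noteq> []"
    using PPlus.prems by (auto split: option.splits if_splits)
  note E = concl_exits[OF H(1)]
  obtain es a where ex: "exits ?T = es @ [a]" using E(4) H(2) list_split_last by blast
  note Z = trans_Plus[OF E(1) ex, of i B]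
  interpret glued ?Z "{[]}" "{0}" "\<lambda>_. ?T" by (rule Z(1))
  have "erase_at ?Z [] (parts ?Z {[]})"
    using final_new[of "[]"] Z(3) unfolding erase_at_def by simp
  thus ?case using parts_erasable PPlus.IH[OF H(1)] finite_parts
    by (blast intro: hereditarily_erasable.intros)
next
  case (PTens p q)
  define T where "T = (\<lambda>i::nat. trans d (if i = 0 then p else q))"
  hence T01: "trans d p = T 0" "trans d q = T (Suc 0)" by simp_all
  let ?Z = "trans d (PTens p q)"
  obtain H K where H: "concl d p = Some H" "concl d q = Some K" "H \<noteq> []" "K \<noteq> []"
    using PTens.prems by (auto split: option.splits if_splits)
  have IH: "hereditarily_erasable (T i)" for i using PTens.IH H unfolding T_def by simp
  have inv: "trans_inv (T 0)" "trans_inv (T (Suc 0))" "exits (T 0) \<noteq> []" "exits (T (Suc 0)) \<noteq> []"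
    using concl_exits(1,3,4)[OF H(1)] concl_exits(1,3,4)[OF H(2)] H(3,4) unfolding T_def by auto
  obtain es a where ex: "exits (T 0) = es @ [a]" using inv list_split_last by blast
  obtain fs b where ex': "exits (T (Suc 0)) = b # fs" using inv by (cases "exits (T (Suc 0))") auto
  note Z = trans_Tens[of d p T q, OF T01 inv(1,2) ex ex']
  interpret glued ?Z "{[]}" "{0, Suc 0}" T by (rule Z(1))
  \<comment> \<open>The tags make the two non-empty node sets differ; this gives the cardinality 2
    in the readiness of a tensor node.\<close>
  have "Cons 0 ` nodes (T 0) \<noteq> Cons (Suc 0) ` nodes (T (Suc 0))" using ne_T[of 0] by auto
  hence "erase_at ?Z [] (parts ?Z {[]})"
    using final_new[of "[]"] Z(3) unfolding erase_at_def comps_delete by simp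
  thus ?case using parts_erasable IH finite_parts
    by (blast intro: hereditarily_erasable.intros)
next
  case (PWith p q)
  define T where "T = (\<lambda>i::nat. trans d (if i = 0 then p else q))"
  hence T01: "trans d p = T 0" "trans d q = T (Suc 0)" by simp_all
  let ?Z = "trans d (PWith p q)"
  obtain H K where H: "concl d p = Some H" "concl d q = Some K" "H \<noteq> []" "K \<noteq> []"
    "butlast H = butlast K"
    using PWith.prems by (auto split: option.splits if_splits)
  have IH: "hereditarily_erasable (T i)" for i using PWith.IH H unfolding T_def by simp
  have inv: "trans_inv (T 0)" "trans_inv (T (Suc 0))" "length (exits (T 0)) = length H"
    "length (exits (T (Suc 0))) = length K" "exits (T 0) \<noteq> []" "exits (T (Suc 0)) \<noteq> []"
    using concl_exits(1,3,4)[OF H(1)] concl_exits(1,3,4)[OF H(2)] H(3,4) unfolding T_def by auto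
  obtain es a where ex: "exits (T 0) = es @ [a]" using inv(5) list_split_last by blast
  obtain fs b where ex': "exits (T (Suc 0)) = fs @ [b]" using inv(6) list_split_last by blast
  have len: "length fs = length es" using arg_cong[OF H(5), of length] inv ex ex' by simp
  note Z = trans_With[of d p T q, OF T01 inv(1,2) ex ex' len]
  let ?D = "insert [] ((\<lambda>j. [2, j]) ` {..<length es})"
  interpret glued ?Z ?D "{0, Suc 0}" T by (rule Z(1))
  have "set (exits ?Z) = ?D" unfolding Z(2) by auto
  moreover have "trans_inv ?Z" using concl_exits(1)[OF PWith.prems] .
  ultimately have ext: "exit_wires ?Z = ?D" unfolding trans_inv_def by metis
  \<comment> \<open>The exits are exactly the new wires, and each of them has the new node of the
    same name as its source.\<close>
  have fin: "{m. final ?Z m} = ?D"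
  proof
    show "?D \<subseteq> {m. final ?Z m}" using final_new by blast
    show "{m. final ?Z m} \<subseteq> ?D"
    proof
      fix m assume "m \<in> {m. final ?Z m}"
      then obtain w where "w \<in> exit_wires ?Z" "src ?Z w = m"
        unfolding final_def exit_wires_def by blast
      thus "m \<in> ?D" using new unfolding ext by metis
    qed
  qed
  have "erase_at ?Z [] (parts ?Z {m. final ?Z m})"
  proof (rule erase_at_ampI)
    show "final ?Z []" by (rule final_new) simp
    show "kind ?Z [] = KBin BWith" by (rule Z(3))
    show "kind ?Z m = KContr" if "final ?Z m" "m \<noteq> []" for m
      using that fin Z(5) by blast
    show "Cons 0 ` nodes (T 0) \<noteq> Cons (Suc 0) ` nodes (T (Suc 0))" using ne_T[of 0] by auto
    show "comps (delete ?Z {m. final ?Z m}) = {Cons 0 ` nodes (T 0), Cons (Suc 0) ` nodes (T (Suc 0))}"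
      unfolding fin comps_delete by simp
    fix m assume "final ?Z m"
    hence m: "m \<in> ?D" using fin by blast
    have ins: "\<exists>w\<in>In ?Z m. src ?Z w \<in> Cons i ` nodes (T i)" if i: "i \<in> {0, Suc 0}" for i
    proof -
      obtain w where w: "w \<in> exit_wires (T i)" "tgt ?Z (i # w) = Some m" using attached[OF i m] by auto
      hence "w \<in> wires (T i)" "src (T i) w \<in> nodes (T i)"
        using wf_T[OF i] unfolding exit_wires_def wf_circuit_def by auto
      thus ?thesis using w i old[OF i, of w] wires_Z unfolding In_def by (intro bexI[of _ "i # w"]) auto
    qed
    show "\<exists>w1\<in>In ?Z m. \<exists>w2\<in>In ?Z m. src ?Z w1 \<in> Cons 0 ` nodes (T 0)
        \<and> src ?Z w2 \<in> Cons (Suc 0) ` nodes (T (Suc 0))"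
      using ins[of 0] ins[of "Suc 0"] by auto
  qed
  hence "erase_at ?Z [] (parts ?Z ?D)" unfolding fin .
  thus ?case using parts_erasable IH finite_parts
    by (blast intro: hereditarily_erasable.intros)
qed

section \<open>Erasable circuits are sequentializable\<close>

text \<open>The part of \<open>is_circuit\<close> that every component inherits when final nodes are
  deleted, stated without the exit list, whose order is restored only at the end.\<close>

definition pre_circuit :: "('a \<Rightarrow> 'a) \<Rightarrow> ('n, 'w, 'a) circuit \<Rightarrow> bool" where
  "pre_circuit d X \<longleftrightarrow> finite (nodes X) \<and> finite (wires X)
   \<and> (\<forall>w\<in>wires X. src X w \<in> nodes X \<and> (\<forall>t. tgt X w = Some t \<longrightarrow> t \<in> nodes X \<and> t \<noteq> src X w))
   \<and> (\<forall>n\<in>nodes X. node_ok d X n) \<and> connected_circ X"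

definition sequentializable_unordered :: "('a \<Rightarrow> 'a) \<Rightarrow> ('n, 'w, 'a) circuit \<Rightarrow> bool" where
  "sequentializable_unordered d X \<longleftrightarrow> (\<exists>p f g. is_proof d p \<and> unordered_iso f g (trans d p) X)"

lemma pre_circuit_wf: "pre_circuit d X \<Longrightarrow> wf_circuit X"
  unfolding pre_circuit_def wf_circuit_def by auto

section \<open>Components left by an erasure step\<close>

lemma exit_wires_part:
  "w \<in> exit_wires (restrict (delete X E) C) \<longleftrightarrow>
     w \<in> wires X \<and> src X w \<notin> E \<and> src X w \<in> C \<and> (\<forall>t. tgt X w = Some t \<longrightarrow> t \<in> E)"
  unfolding exit_wires_def by (auto split: option.splits if_splits)

lemma connected_restrict:
  assumes wf: "wf_circuit X" and C: "C \<in> comps X"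
  shows "connected_circ (restrict X C)"
proof -
  have *: "m \<in> C \<and> (n, m) \<in> (adj (restrict X C))\<^sup>*" if "n \<in> C" "(n, m) \<in> (adj X)\<^sup>*" for n m
    using that(2)
  proof (induction rule: rtrancl_induct)
    case base thus ?case using that by auto
  next
    case (step y z)
    have "z \<in> C \<and> (y, z) \<in> adj (restrict X C)" using step(2)
    proof (cases rule: adjE)
      case (1 w)
      thus ?thesis using comps_closed[OF wf C 1(1,3)] step.IH adjI(1)[of w "restrict X C" z] by auto
    next
      case (2 w)
      thus ?thesis using comps_closed[OF wf C 2(1,3)] step.IH adjI(2)[of w "restrict X C" y] by auto
    qed
    thus ?case using step.IH by auto
  qed
  show ?thesis unfolding connected_circ_def restrict_simps
    using *[OF _ comps_connected[OF C]] by blast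
qed

text \<open>By \<open>E\<close>, the deleted nodes emit only exits, so a wire entering a surviving
  node is not removed, and its source lies in the same component. Hence a surviving node keeps all
  its wires and remains correctly typed.\<close>

lemma pre_circuit_part:
  assumes pre: "pre_circuit d X" and E: "\<And>w. w \<in> wires X \<Longrightarrow> src X w \<in> E \<Longrightarrow> tgt X w = None"
    and C: "C \<in> comps (delete X E)"
  shows "pre_circuit d (restrict (delete X E) C)" (is "pre_circuit d ?Y")
proof -
  note wf = wf_delete[OF pre_circuit_wf[OF pre], of E]
  have CX: "C \<subseteq> nodes X - E" using comps_subset[OF C] by simp
  have "node_ok d ?Y n" if n: "n \<in> C" for n
  proof -
    have Out: "Out ?Y n = Out X n" using n CX unfolding Out_def by auto
    have In: "In ?Y n = In X n"
    proof
      show "In ?Y n \<subseteq> In X n" unfolding In_def by (auto split: option.splits if_splits)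
      show "In X n \<subseteq> In ?Y n"
      proof
        fix w assume "w \<in> In X n"
        hence w: "w \<in> wires X" "tgt X w = Some n" unfolding In_def by auto
        have w': "w \<in> wires (delete X E)" "tgt (delete X E) w = Some n"
          using w E[OF w(1)] n CX by auto
        thus "w \<in> In ?Y n" using comps_closed[OF wf C w'] n w unfolding In_def by auto
      qed
    qed
    have "node_ok d X n" using pre n CX unfolding pre_circuit_def by auto
    thus ?thesis unfolding node_ok_def In Out restrict_simps delete_simps .
  qed
  moreover have "wf_circuit ?Y" by (rule wf_restrict[OF wf C])
  moreover have "finite C" using pre CX finite_subset unfolding pre_circuit_def by blast
  moreover have "t \<noteq> src ?Y w" if "w \<in> wires ?Y" "tgt ?Y w = Some t" for w t
    using that pre unfolding pre_circuit_def by (auto split: option.splits if_splits)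
  moreover have "finite (wires ?Y)" using pre unfolding pre_circuit_def by simp
  ultimately show ?thesis using connected_restrict[OF wf C]
    unfolding pre_circuit_def wf_circuit_def restrict_simps(1) by blast
qed

text \<open>If no wire led from \<open>C\<close> into \<open>N\<close>, then \<open>C\<close> would
  be closed under all wires of \<open>X\<close>, because \<open>N\<close> emits only exits; by
  connectedness \<open>C\<close> would then contain \<open>N\<close>.\<close>

lemma comps_delete_touch:
  assumes conn: "connected_circ X" and wf: "wf_circuit X" and N: "N \<in> nodes X"
    and out: "\<And>w. w \<in> wires X \<Longrightarrow> src X w = N \<Longrightarrow> tgt X w = None"
    and C: "C \<in> comps (delete X {N})"
  shows "\<exists>w\<in>In X N. src X w \<in> C"
proof (rule ccontr)
  assume neg: "\<not> ?thesis"
  have CX: "C \<subseteq> nodes X - {N}" using comps_subset[OF C] by simp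
  obtain n where n: "n \<in> C" using comps_nonempty[OF C] by auto
  have "N \<in> C"
  proof (rule adj_rtrancl_closed)
    show "(n, N) \<in> (adj X)\<^sup>*" using conn n N CX unfolding connected_circ_def by auto
    show "n \<in> C" by (rule n)
    fix w t assume w: "w \<in> wires X" "tgt X w = Some t"
    have "src X w \<noteq> N" using out w by auto
    show "src X w \<in> C \<longleftrightarrow> t \<in> C"
    proof (cases "t = N")
      case True
      thus ?thesis using neg w CX unfolding In_def by auto
    next
      case False
      thus ?thesis using comps_closed[OF wf_delete[OF wf] C, of w t] w \<open>src X w \<noteq> N\<close> by auto
    qed
  qed
  thus False using CX by auto
qed

section \<open>Reordering of exits and gluing of isomorphisms\<close>

lemma unordered_iso_exit_wires:
  assumes "unordered_iso f g X Y"
  shows "bij_betw g (exit_wires X) (exit_wires Y)"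
proof -
  have g: "inj_on g (wires X)" "wires Y = g ` wires X"
    using assms unfolding unordered_iso_def graph_iso_def bij_betw_def by auto
  have "tgt Y (g w) = None \<longleftrightarrow> tgt X w = None" if "w \<in> wires X" for w
    using assms that unfolding unordered_iso_def graph_iso_def by auto
  hence "g ` exit_wires X = exit_wires Y" unfolding exit_wires_def g(2) by auto
  moreover have "inj_on g (exit_wires X)"
    by (rule inj_on_subset[OF g(1)]) (auto simp: exit_wires_def)
  ultimately show ?thesis unfolding bij_betw_def by simp
qed

lemma sequentializable_with_exits:
  assumes "sequentializable_unordered d Y" "distinct L" "set L = exit_wires Y"
  shows "\<exists>p f g. is_proof d p \<and> unordered_iso f g (trans d p) Y \<and> map g (exits (trans d p)) = L"
proof -
  obtain p f g where p: "is_proof d p" "unordered_iso f g (trans d p) Y"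
    using assms(1) unfolding sequentializable_unordered_def by auto
  then obtain G where G: "concl d p = Some G" unfolding is_proof_def by auto
  define T where "T = trans d p"
  define E where "E = exits T"
  note inv = concl_exits[OF G, folded T_def]
  have E: "distinct E" "set E = exit_wires T" "length G = length E"
    using inv unfolding trans_inv_def E_def by auto
  have bij: "bij_betw g (set E) (set L)"
    using unordered_iso_exit_wires[OF p(2)] unfolding T_def[symmetric] E(2) assms(3) .
  \<comment> \<open>\<open>h\<close> maps a position in the exit list of the translation to the
    corresponding wire of \<open>Y\<close>. Its inverse lists the positions in the order of
    \<open>L\<close>, and this list is the permutation to be applied.\<close>
  define h where "h = (\<lambda>i. g (E ! i))"
  have h: "bij_betw h {..<length E} (set L)"
    unfolding h_def using bij_betw_trans[OF bij_betw_nth[OF E(1) refl refl] bij]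
    by (simp add: comp_def)
  define ss where "ss = map (inv_into {..<length E} h) L"
  have hss: "map h ss = L"
    unfolding ss_def map_map by (rule map_idI) (use bij_betw_inv_into_right[OF h] in auto)
  have ss: "distinct ss" using assms(2) hss distinct_map by metis
  have "set ss = inv_into {..<length E} h ` set L" unfolding ss_def by simp
  hence set_ss: "set ss = {..<length G}"
    using bij_betw_inv_into[OF h] E(3) unfolding bij_betw_def by simp
  have "is_proof d (PPerm ss p)" using G ss set_ss unfolding is_proof_def by simp
  moreover have tr: "trans d (PPerm ss p) = T\<lparr>exits := map ((!) E) ss\<rparr>"
    unfolding T_def E_def by (simp add: trans.simps Let_def)
  moreover have "unordered_iso f g (trans d (PPerm ss p)) Y"
    using p(2) unfolding tr unordered_iso_def graph_iso_def designated_def T_def by simp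
  moreover have "map g (exits (trans d (PPerm ss p))) = L"
    using hss unfolding tr h_def by (simp add: comp_def)
  ultimately show ?thesis by blast
qed

text \<open>Names in a glued circuit are either new or tagged by a premise index, so a map on them
  can be defined by inspecting \<open>D\<close> and then splitting off the tag. The lemma serves for
  nodes and for wires.\<close>

lemma bij_betw_tagged:
  assumes "inj_on \<phi> D" and fresh: "\<And>i x. i \<in> I \<Longrightarrow> i # x \<notin> D"
    and bij: "\<And>i. i \<in> I \<Longrightarrow> bij_betw (f i) (A i) (B i)"
    and disj: "\<And>i. i \<in> I \<Longrightarrow> \<phi> ` D \<inter> B i = {}"
      "\<And>i j. i \<in> I \<Longrightarrow> j \<in> I \<Longrightarrow> i \<noteq> j \<Longrightarrow> B i \<inter> B j = {}"
  shows "bij_betw (\<lambda>x. if x \<in> D then \<phi> x else f (hd x) (tl x))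
    (D \<union> (\<Union>i\<in>I. Cons i ` A i)) (\<phi> ` D \<union> (\<Union>i\<in>I. B i))" (is "bij_betw ?F _ _")
proof -
  have FD: "?F x = \<phi> x" if "x \<in> D" for x using that by simp
  have FI: "?F (i # x) = f i x" if "i \<in> I" for i x using fresh[OF that] by simp
  have im: "f i ` A i = B i" if "i \<in> I" for i using bij[OF that] unfolding bij_betw_def by simp
  have inj: "f i x = f j y \<Longrightarrow> i = j \<and> x = y" if "i \<in> I" "j \<in> I" "x \<in> A i" "y \<in> A j" for i j x y
    using bij[OF that(1)] im[OF that(1)] im[OF that(2)] disj(2)[OF that(1,2)] that
    unfolding bij_betw_def inj_on_def by blast
  have inj': "\<phi> x \<noteq> f i y" if "x \<in> D" "i \<in> I" "y \<in> A i" for x i y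
    using disj(1)[OF that(2)] im[OF that(2)] that by blast
  have "inj_on ?F (D \<union> (\<Union>i\<in>I. Cons i ` A i))"
  proof (rule inj_onI)
    fix x y assume x: "x \<in> D \<union> (\<Union>i\<in>I. Cons i ` A i)" and y: "y \<in> D \<union> (\<Union>i\<in>I. Cons i ` A i)"
      and eq: "?F x = ?F y"
    show "x = y"
    proof (cases "x \<in> D")
      case xD: True
      show ?thesis
      proof (cases "y \<in> D")
        case True thus ?thesis using xD eq assms(1) by (auto dest: inj_onD)
      next
        case False
        then obtain j y' where "j \<in> I" "y' \<in> A j" "y = j # y'" using y by auto
        thus ?thesis using eq inj'[OF xD] FD[OF xD] FI by metis
      qed
    next
      case False
      then obtain i x' where x': "i \<in> I" "x' \<in> A i" "x = i # x'" using x by auto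
      show ?thesis
      proof (cases "y \<in> D")
        case True thus ?thesis using eq inj'[OF True x'(1,2)] FD[OF True] FI[OF x'(1)] x' by metis
      next
        case False
        then obtain j y' where y': "j \<in> I" "y' \<in> A j" "y = j # y'" using y by auto
        show ?thesis using eq inj[OF x'(1) y'(1) x'(2) y'(2)] FI[OF x'(1)] FI[OF y'(1)] x' y' by metis
      qed
    qed
  qed
  moreover have "?F ` (D \<union> (\<Union>i\<in>I. Cons i ` A i)) = ?F ` D \<union> (\<Union>i\<in>I. (\<lambda>x. ?F (i # x)) ` A i)"
    by (simp only: image_Un image_UN image_image)
  moreover have "?F ` D = \<phi> ` D" by simp
  moreover have "(\<Union>i\<in>I. (\<lambda>x. ?F (i # x)) ` A i) = (\<Union>i\<in>I. B i)"
    using FI im by (intro SUP_cong) auto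
  ultimately show ?thesis unfolding bij_betw_def by metis
qed

text \<open>Here \<open>\<phi>\<close> sends new nodes to the deleted nodes of \<open>X\<close>, and
  \<open>\<gamma>\<close> sends the new wires to their outputs. The isomorphisms of the parts see
  the wires cut by the deletion only as exits; their targets and designations in \<open>X\<close>
  are supplied by \<open>ext\<close> and \<open>left\<close>.\<close>

lemma (in glued) glued_unordered_iso:
  fixes X :: "('n, 'w, 'a) circuit"
  assumes wf: "wf_circuit X" and \<phi>: "inj_on \<phi> D" "\<phi> ` D \<subseteq> nodes X"
    and comps: "comps (delete X (\<phi> ` D)) = C ` I" "inj_on C I"
    and iso: "\<And>i. i \<in> I \<Longrightarrow> unordered_iso (f i) (g i) (T i) (restrict (delete X (\<phi> ` D)) (C i))"
    and \<gamma>: "\<And>x. x \<in> D \<Longrightarrow> Out X (\<phi> x) = {\<gamma> x} \<and> tgt X (\<gamma> x) = None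
          \<and> lab X (\<gamma> x) = lab Z x \<and> kind X (\<phi> x) = kind Z x"
    and ext: "\<And>i w. i \<in> I \<Longrightarrow> w \<in> exit_wires (T i) \<Longrightarrow> tgt X (g i w) = map_option \<phi> (tgt Z (i # w))"
    and left: "\<And>i w x. i \<in> I \<Longrightarrow> w \<in> exit_wires (T i) \<Longrightarrow> tgt Z (i # w) = Some x \<Longrightarrow>
          kind Z x \<noteq> KContr \<Longrightarrow> isleft X (g i w) = isleft Z (i # w)"
  shows "\<exists>F G. unordered_iso F G Z X"
proof -
  define F where "F = (\<lambda>x. if x \<in> D then \<phi> x else f (hd x) (tl x))"
  define G where "G = (\<lambda>x. if x \<in> D then \<gamma> x else g (hd x) (tl x))"
  have FD: "F x = \<phi> x" "G x = \<gamma> x" if "x \<in> D" for x using that unfolding F_def G_def by auto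
  have FI: "F (i # x) = f i x" "G (i # x) = g i x" if "i \<in> I" for i x
    using fresh[OF that] unfolding F_def G_def by auto
  have Cne: "C i \<inter> C j = {}" if "i \<in> I" "j \<in> I" "i \<noteq> j" for i j
  proof -
    have "C i \<in> comps (delete X (\<phi> ` D))" "C j \<in> comps (delete X (\<phi> ` D))" "C i \<noteq> C j"
      using comps that by (auto dest: inj_onD)
    thus ?thesis using comps_disjoint[of "C i" _ "C j"] by auto
  qed
  have CX: "C i \<subseteq> nodes X - \<phi> ` D" if "i \<in> I" for i
    using comps_subset[of "C i" "delete X (\<phi> ` D)"] comps that by auto
  have NX: "nodes X = \<phi> ` D \<union> (\<Union>i\<in>I. C i)"
    using Union_comps[of "delete X (\<phi> ` D)"] comps \<phi>(2) by auto
  define W where "W = (\<lambda>i. {w \<in> wires X. src X w \<in> C i})"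
  have fi: "bij_betw (f i) (nodes (T i)) (C i)" "\<And>n. n \<in> nodes (T i) \<Longrightarrow> kind X (f i n) = kind (T i) n"
    and gi: "bij_betw (g i) (wires (T i)) (W i)" if "i \<in> I" for i
  proof -
    have "wires (restrict (delete X (\<phi> ` D)) (C i)) = W i" using CX[OF that] unfolding W_def by auto
    thus "bij_betw (f i) (nodes (T i)) (C i)" "\<And>n. n \<in> nodes (T i) \<Longrightarrow> kind X (f i n) = kind (T i) n"
      "bij_betw (g i) (wires (T i)) (W i)"
      using iso[OF that] unfolding unordered_iso_def graph_iso_def by (auto simp del: restrict_simps(2))
  qed
  have gw: "src X (g i w) = f i (src (T i) w)" "lab X (g i w) = lab (T i) w"
    "tgt (delete X (\<phi> ` D)) (g i w) = map_option (f i) (tgt (T i) w)"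
    "designated (T i) w \<Longrightarrow> isleft X (g i w) = isleft (T i) w"
    if "i \<in> I" "w \<in> wires (T i)" for i w
    using iso[OF that(1)] that(2) unfolding unordered_iso_def graph_iso_def by auto
  have \<gamma>w: "\<gamma> x \<in> wires X" "src X (\<gamma> x) = \<phi> x" if "x \<in> D" for x
    using \<gamma>[OF that] unfolding Out_def by auto
  have WX: "wires X = \<gamma> ` D \<union> (\<Union>i\<in>I. W i)"
  proof
    show "wires X \<subseteq> \<gamma> ` D \<union> (\<Union>i\<in>I. W i)"
    proof
      fix w assume w: "w \<in> wires X"
      hence "src X w \<in> \<phi> ` D \<union> (\<Union>i\<in>I. C i)" using wf NX unfolding wf_circuit_def by auto
      thus "w \<in> \<gamma> ` D \<union> (\<Union>i\<in>I. W i)" using w \<gamma> unfolding W_def Out_def by blast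
    qed
  qed (use \<gamma>w in \<open>auto simp: W_def\<close>)
  \<comment> \<open>The source of an output wire determines its node.\<close>
  have inj\<gamma>: "inj_on \<gamma> D" using \<gamma>w(2) \<phi>(1) unfolding inj_on_def by metis
  have bF: "bij_betw F (nodes Z) (nodes X)"
    unfolding F_def nodes_Z NX
    by (rule bij_betw_tagged[OF \<phi>(1) fresh fi(1)]) (use CX Cne in auto)
  have bG: "bij_betw G (wires Z) (wires X)"
    unfolding G_def wires_Z WX
  proof (rule bij_betw_tagged[OF inj\<gamma> fresh gi])
    show "\<gamma> ` D \<inter> W i = {}" if "i \<in> I" for i
      using \<gamma>w CX[OF that] unfolding W_def by auto
    show "W i \<inter> W j = {}" if "i \<in> I" "j \<in> I" "i \<noteq> j" for i j
      using Cne[OF that] unfolding W_def by auto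
  qed
  have wZ: "src X (G w) = F (src Z w) \<and> tgt X (G w) = map_option F (tgt Z w) \<and> lab X (G w) = lab Z w
      \<and> (designated Z w \<longrightarrow> isleft X (G w) = isleft Z w)" if "w \<in> wires Z" for w
  proof (cases "w \<in> D")
    case True
    thus ?thesis using new[OF True] \<gamma>[OF True] \<gamma>w[OF True] FD[OF True] by (simp add: designated_def)
  next
    case False
    then obtain i v where v: "i \<in> I" "v \<in> wires (T i)" "w = i # v" using \<open>w \<in> wires Z\<close> wires_Z by auto
    note o = old[OF v(1,2)] and gv = gw[OF v(1,2)]
    show ?thesis
    proof (cases "tgt (T i) v")
      case None
      hence ex: "v \<in> exit_wires (T i)" using v unfolding exit_wires_def by simp
      have "map_option \<phi> (tgt Z w) = map_option F (tgt Z w)"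
        using outer[OF v(1) ex] FD v(3) by (cases "tgt Z w") auto
      moreover have "isleft X (g i v) = isleft Z w" if "designated Z w"
        using that left[OF v(1) ex] v(3) unfolding designated_def by auto
      ultimately show ?thesis using o gv ext[OF v(1) ex] FI[OF v(1)] v(3) by simp
    next
      case (Some t)
      have t: "t \<in> nodes (T i)" using Some wf_T[OF v(1)] v(2) unfolding wf_circuit_def by auto
      \<comment> \<open>A wire that still has a target after the deletion had the same target before
        it.\<close>
      have "tgt X (g i v) = Some (f i t)"
        using gv(3) Some by (auto split: option.splits if_splits)
      moreover have "designated (T i) v" if "designated Z w"
        using that inner[OF v(1,2) Some] Some v(3) kind_old[OF v(1) t] unfolding designated_def by auto
      ultimately show ?thesis using o gv FI[OF v(1)] v(3) inner[OF v(1,2) Some] by auto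
    qed
  qed
  have "kind X (F n) = kind Z n" if n: "n \<in> nodes Z" for n
  proof (cases "n \<in> D")
    case True thus ?thesis using \<gamma>[OF True] FD by simp
  next
    case False
    then obtain i m where "i \<in> I" "m \<in> nodes (T i)" "n = i # m" using n nodes_Z by auto
    thus ?thesis using fi(2) kind_old FI by simp
  qed
  hence "unordered_iso F G Z X" using bF bG wZ unfolding unordered_iso_def graph_iso_def by auto
  thus ?thesis by blast
qed

lemma unordered_iso_trans_exits:
  assumes "is_proof d p" "unordered_iso f g (trans d p) Y"
  shows "trans_inv (trans d p)" "exit_wires (trans d p) = set (exits (trans d p))"
    "w \<in> exit_wires (trans d p) \<Longrightarrow> g w \<in> exit_wires Y \<and> lab Y (g w) = lab (trans d p) w"
    "inj_on g (exit_wires (trans d p))"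
    "concl d p = Some (map (lab (trans d p)) (exits (trans d p)))"
proof -
  obtain G where G: "concl d p = Some G" using assms(1) unfolding is_proof_def by auto
  show "trans_inv (trans d p)" "concl d p = Some (map (lab (trans d p)) (exits (trans d p)))"
    using concl_exits(1,2)[OF G] G by auto
  thus "exit_wires (trans d p) = set (exits (trans d p))" unfolding trans_inv_def by simp
  note bij = unordered_iso_exit_wires[OF assms(2)]
  thus "inj_on g (exit_wires (trans d p))" unfolding bij_betw_def by simp
  show "g w \<in> exit_wires Y \<and> lab Y (g w) = lab (trans d p) w" if "w \<in> exit_wires (trans d p)"
    using that bij assms(2) unfolding bij_betw_def unordered_iso_def exit_wires_def by auto
qed

lemma obtain_remaining_exits:
  assumes "pre_circuit d Y" "A \<subseteq> exit_wires Y"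
  obtains L where "distinct L" "set L = exit_wires Y - A"
  using finite_distinct_list[of "exit_wires Y - A"] assms
  unfolding pre_circuit_def exit_wires_def by auto

section \<open>The last inference for each kind of ready node\<close>

lemma sequentializable_Plus:
  assumes pre: "pre_circuit d X" and N: "N \<in> nodes X" "kind X N = KPlus"
    and out: "\<And>w. w \<in> wires X \<Longrightarrow> src X w = N \<Longrightarrow> tgt X w = None"
    and parts: "\<And>Y. Y \<in> parts X {N} \<Longrightarrow> sequentializable_unordered d Y"
  shows "sequentializable_unordered d X"
proof -
  note wf = pre_circuit_wf[OF pre]
  have "node_ok d X N" using pre N unfolding pre_circuit_def by auto
  then obtain wi ow B where w: "In X N = {wi}" "Out X N = {ow}"
    "lab X ow = (if isleft X wi then Plus (lab X wi) B else Plus B (lab X wi))"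
    using N(2) unfolding node_ok_def by auto
  have wi: "wi \<in> wires X" "tgt X wi = Some N" "src X wi \<in> nodes X" "src X wi \<noteq> N"
    using w(1) pre unfolding In_def pre_circuit_def by auto
  have ow: "ow \<in> wires X" "src X ow = N" "tgt X ow = None" using w(2) out unfolding Out_def by auto
  obtain C where C: "C \<in> comps (delete X {N})" "src X wi \<in> C"
    using Union_comps[of "delete X {N}"] wi by auto
  have conn: "connected_circ X" using pre unfolding pre_circuit_def by auto
  \<comment> \<open>Readiness of a plus node says nothing about components, but each component sends
    a wire to \<open>N\<close>, and \<open>wi\<close> is the only wire entering
    \<open>N\<close>.\<close>
  have "C' = C" if "C' \<in> comps (delete X {N})" for C'
    using comps_delete_touch[OF conn wf N(1) out that] w(1) comps_disjoint[OF that C(1) _ C(2)] by auto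
  hence comps: "comps (delete X {N}) = {C}" using C(1) by blast
  let ?Y = "restrict (delete X {N}) C"
  have Y: "sequentializable_unordered d ?Y" using parts comps unfolding parts_def by simp
  have preY: "pre_circuit d ?Y" using pre_circuit_part[OF pre _ C(1)] out by auto
  have wiY: "wi \<in> exit_wires ?Y" unfolding exit_wires_part using wi C by auto
  obtain L where L: "distinct L" "set L = exit_wires ?Y - {wi}"
    using obtain_remaining_exits[OF preY, of "{wi}"] wiY by auto
  have "distinct (L @ [wi])" "set (L @ [wi]) = exit_wires ?Y" using L wiY by auto
  from sequentializable_with_exits[OF Y this] obtain p f g where
    p: "is_proof d p" "unordered_iso f g (trans d p) ?Y" "map g (exits (trans d p)) = L @ [wi]" by auto
  then obtain es a where ex: "exits (trans d p) = es @ [a]" "g a = wi"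
    by (auto simp: map_eq_append_conv)
  note P = unordered_iso_trans_exits[OF p(1,2)]
  \<comment> \<open>The flag of \<open>PPlus\<close> is true when the premise formula is the right
    summand, the opposite of \<open>isleft\<close>.\<close>
  let ?Z = "trans d (PPlus (\<not> isleft X wi) B p)"
  note Z = trans_Plus[OF P(1) ex(1), of "\<not> isleft X wi" B]
  interpret glued ?Z "{[]}" "{0}" "\<lambda>_. trans d p" by (rule Z(1))
  have a: "a \<in> exit_wires (trans d p)" unfolding P(2) ex by simp
  \<comment> \<open>An exit of the part is an exit of \<open>X\<close> unless it was cut, and the
    only cut wire is \<open>wi\<close>.\<close>
  have tg: "tgt X (g v) = map_option (\<lambda>_. N) (tgt ?Z (0 # v))" if v: "v \<in> exit_wires (trans d p)" for v
  proof (cases "v = a")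
    case True thus ?thesis using ex wi Z(5) by simp
  next
    case False
    hence "g v \<noteq> wi" using P(4) v a ex(2) by (auto dest: inj_onD)
    hence "tgt X (g v) = None"
      using P(3)[OF v] w(1) unfolding exit_wires_part In_def by (cases "tgt X (g v)") auto
    thus ?thesis using Z(5) False v unfolding exit_wires_def by simp
  qed
  have "\<exists>F G. unordered_iso F G ?Z X"
  proof (rule glued_unordered_iso[where \<phi> = "\<lambda>_. N" and \<gamma> = "\<lambda>_. ow" and C = "\<lambda>_. C" and f = "\<lambda>_. f" and g = "\<lambda>_. g"])
    show "Out X N = {ow} \<and> tgt X ow = None \<and> lab X ow = lab ?Z x \<and> kind X N = kind ?Z x"
      if "x \<in> {[]}" for x
      using that w ow N(2) Z(3,4) P(3)[OF a] ex(2) by simp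
    show "isleft X (g v) = isleft ?Z (i # v)"
      if "i \<in> {0}" "v \<in> exit_wires (trans d p)" "tgt ?Z (i # v) = Some x" for i v x
    proof -
      have "v = a" using that Z(5)[of v] unfolding exit_wires_def by (auto split: if_splits)
      thus ?thesis using Z(6) ex(2) that(1) by simp
    qed
  qed (use wf N comps p(2) tg in auto)
  moreover have "is_proof d (PPlus (\<not> isleft X wi) B p)"
    using P(5) ex unfolding is_proof_def by simp
  ultimately show ?thesis unfolding sequentializable_unordered_def by blast
qed

lemma node_ok_BinE:
  assumes "pre_circuit d X" "N \<in> nodes X" "kind X N = KBin b"
    and out: "\<And>w. w \<in> wires X \<Longrightarrow> src X w = N \<Longrightarrow> tgt X w = None"
  obtains wl wr ow where "wl \<noteq> wr" "In X N = {wl, wr}" "isleft X wl" "\<not> isleft X wr"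
    "Out X N = {ow}" "tgt X ow = None" "lab X ow = binf b (lab X wl) (lab X wr)"
    "\<forall>w\<in>{wl, wr}. w \<in> wires X \<and> tgt X w = Some N \<and> src X w \<in> nodes X \<and> src X w \<noteq> N"
proof -
  have "node_ok d X N" using assms unfolding pre_circuit_def by auto
  then obtain wl wr ow where w: "wl \<noteq> wr" "In X N = {wl, wr}" "isleft X wl" "\<not> isleft X wr"
    "Out X N = {ow}" "lab X ow = binf b (lab X wl) (lab X wr)"
    using assms(3) unfolding node_ok_def by auto
  moreover have "tgt X ow = None" using w(5) out unfolding Out_def by auto
  moreover have "\<forall>w\<in>{wl, wr}. w \<in> wires X \<and> tgt X w = Some N \<and> src X w \<in> nodes X \<and> src X w \<noteq> N"
    unfolding w(2)[symmetric] using assms(1) unfolding In_def pre_circuit_def by auto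
  ultimately show ?thesis using that by blast
qed

lemma sequentializable_Par:
  assumes pre: "pre_circuit d X" and N: "N \<in> nodes X" "kind X N = KBin BPar"
    and out: "\<And>w. w \<in> wires X \<Longrightarrow> src X w = N \<Longrightarrow> tgt X w = None"
    and card: "card (comps (delete X {N})) = 1"
    and parts: "\<And>Y. Y \<in> parts X {N} \<Longrightarrow> sequentializable_unordered d Y"
  shows "sequentializable_unordered d X"
proof -
  note wf = pre_circuit_wf[OF pre]
  obtain wl wr ow where w: "wl \<noteq> wr" "In X N = {wl, wr}" "isleft X wl" "\<not> isleft X wr"
    "Out X N = {ow}" "tgt X ow = None" "lab X ow = Par (lab X wl) (lab X wr)"
    and ww': "\<forall>w\<in>{wl, wr}. w \<in> wires X \<and> tgt X w = Some N \<and> src X w \<in> nodes X \<and> src X w \<noteq> N"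
    by (rule node_ok_BinE[OF pre N out, unfolded binf.simps])
  note ww = bspec[OF ww']
  obtain C where comps: "comps (delete X {N}) = {C}" using card by (auto simp: card_1_singleton_iff)
  hence C: "C \<in> comps (delete X {N})" "C = nodes X - {N}" using Union_comps[of "delete X {N}"] by auto
  let ?Y = "restrict (delete X {N}) C"
  have Y: "sequentializable_unordered d ?Y" using parts comps unfolding parts_def by simp
  have preY: "pre_circuit d ?Y" using pre_circuit_part[OF pre _ C(1)] out by auto
  have wY: "wl \<in> exit_wires ?Y" "wr \<in> exit_wires ?Y"
    unfolding exit_wires_part using ww[of wl] ww[of wr] C(2) by auto
  obtain L where L: "distinct L" "set L = exit_wires ?Y - {wl, wr}"
    using obtain_remaining_exits[OF preY, of "{wl, wr}"] wY by auto
  \<comment> \<open>\<open>PPar\<close> consumes the last two exits, the left one first.\<close>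
  have "distinct (L @ [wl, wr])" "set (L @ [wl, wr]) = exit_wires ?Y" using L wY w(1) by auto
  from sequentializable_with_exits[OF Y this] obtain p f g where
    p: "is_proof d p" "unordered_iso f g (trans d p) ?Y" "map g (exits (trans d p)) = L @ [wl, wr]" by auto
  then obtain es a b where ex: "exits (trans d p) = es @ [a, b]" "g a = wl" "g b = wr"
    by (auto simp: map_eq_append_conv)
  note P = unordered_iso_trans_exits[OF p(1,2)]
  let ?Z = "trans d (PPar p)"
  note Z = trans_Par[OF P(1) ex(1)]
  interpret glued ?Z "{[]}" "{0}" "\<lambda>_. trans d p" by (rule Z(1))
  have ab: "a \<in> exit_wires (trans d p)" "b \<in> exit_wires (trans d p)" unfolding P(2) ex by auto
  have tg: "tgt X (g v) = map_option (\<lambda>_. N) (tgt ?Z (0 # v))" if v: "v \<in> exit_wires (trans d p)" for v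
  proof (cases "v \<in> {a, b}")
    case True thus ?thesis using ex ww[of wl] ww[of wr] Z(5)[of v] by auto
  next
    case False
    hence "g v \<noteq> wl" "g v \<noteq> wr" using P(4) v ab ex(2,3) by (auto dest: inj_onD)
    hence "tgt X (g v) = None"
      using P(3)[OF v] w(2) unfolding exit_wires_part In_def by (cases "tgt X (g v)") auto
    thus ?thesis using Z(5) False v unfolding exit_wires_def by simp
  qed
  have "\<exists>F G. unordered_iso F G ?Z X"
  proof (rule glued_unordered_iso[where \<phi> = "\<lambda>_. N" and \<gamma> = "\<lambda>_. ow" and C = "\<lambda>_. C" and f = "\<lambda>_. f" and g = "\<lambda>_. g"])
    show "Out X N = {ow} \<and> tgt X ow = None \<and> lab X ow = lab ?Z x \<and> kind X N = kind ?Z x"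
      if "x \<in> {[]}" for x
      using that w N(2) Z(3,4) P(3)[OF ab(1)] P(3)[OF ab(2)] ex(2,3) by simp
    show "isleft X (g v) = isleft ?Z (i # v)"
      if "i \<in> {0}" "v \<in> exit_wires (trans d p)" "tgt ?Z (i # v) = Some x" for i v x
    proof -
      have "v = a \<or> v = b" using that Z(5)[of v] unfolding exit_wires_def by (auto split: if_splits)
      thus ?thesis using Z(6,7) ex(2,3) that(1) w(3,4) by auto
    qed
  qed (use wf N comps p(2) tg in auto)
  moreover have "is_proof d (PPar p)"
    using P(5) ex unfolding is_proof_def by simp
  ultimately show ?thesis unfolding sequentializable_unordered_def by blast
qed

lemma sequentializable_Tens:
  assumes pre: "pre_circuit d X" and N: "N \<in> nodes X" "kind X N = KBin BTens"
    and out: "\<And>w. w \<in> wires X \<Longrightarrow> src X w = N \<Longrightarrow> tgt X w = None"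
    and card: "card (comps (delete X {N})) = 2"
    and parts: "\<And>Y. Y \<in> parts X {N} \<Longrightarrow> sequentializable_unordered d Y"
  shows "sequentializable_unordered d X"
proof -
  note wf = pre_circuit_wf[OF pre]
  obtain wl wr ow where w: "wl \<noteq> wr" "In X N = {wl, wr}" "isleft X wl" "\<not> isleft X wr"
    "Out X N = {ow}" "tgt X ow = None" "lab X ow = Tens (lab X wl) (lab X wr)"
    and ww': "\<forall>w\<in>{wl, wr}. w \<in> wires X \<and> tgt X w = Some N \<and> src X w \<in> nodes X \<and> src X w \<noteq> N"
    by (rule node_ok_BinE[OF pre N out, unfolded binf.simps])
  note ww = bspec[OF ww']
  have conn: "connected_circ X" using pre unfolding pre_circuit_def by auto
  obtain C0 where C0: "C0 \<in> comps (delete X {N})" "src X wl \<in> C0"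
    using Union_comps[of "delete X {N}"] ww[of wl] by auto
  obtain A B where "comps (delete X {N}) = {A, B}" "A \<noteq> B" using card by (meson card_2_iff)
  then obtain C1 where comps: "comps (delete X {N}) = {C0, C1}" "C0 \<noteq> C1"
    using C0(1) by (metis insert_commute insertE singletonD)
  hence C1: "C1 \<in> comps (delete X {N})" by simp
  have disj: "C0 \<inter> C1 = {}" using comps_disjoint[OF C0(1) C1] comps(2) by blast
  \<comment> \<open>The component \<open>C1\<close> must send a wire to \<open>N\<close>; it cannot
    be \<open>wl\<close>, which starts in \<open>C0\<close>, so it is \<open>wr\<close>.\<close>
  have C1wr: "src X wr \<in> C1"
    using comps_delete_touch[OF conn wf N(1) out C1] w(2) C0(2) disj by auto
  define C where "C = (\<lambda>i::nat. if i = 0 then C0 else C1)"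
  let ?Y = "\<lambda>C. restrict (delete X {N}) C"
  have Y: "sequentializable_unordered d (?Y C0)" "sequentializable_unordered d (?Y C1)"
    using parts comps unfolding parts_def by auto
  have preY: "pre_circuit d (?Y C0)" "pre_circuit d (?Y C1)"
    using pre_circuit_part[OF pre _ C0(1)] pre_circuit_part[OF pre _ C1] out by auto
  have wY: "wl \<in> exit_wires (?Y C0)" "wr \<in> exit_wires (?Y C1)"
    unfolding exit_wires_part using ww[of wl] ww[of wr] C0(2) C1wr by auto
  obtain L0 where "distinct L0" "set L0 = exit_wires (?Y C0) - {wl}"
    using obtain_remaining_exits[OF preY(1), of "{wl}"] wY by auto
  hence "distinct (L0 @ [wl])" "set (L0 @ [wl]) = exit_wires (?Y C0)" using wY by auto
  from sequentializable_with_exits[OF Y(1) this] obtain p f0 g0 where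
    p: "is_proof d p" "unordered_iso f0 g0 (trans d p) (?Y C0)" "map g0 (exits (trans d p)) = L0 @ [wl]"
    by auto
  obtain L1 where "distinct L1" "set L1 = exit_wires (?Y C1) - {wr}"
    using obtain_remaining_exits[OF preY(2), of "{wr}"] wY by auto
  \<comment> \<open>\<open>PTens\<close> takes the first exit of its second premise, hence
    \<open>wr\<close> at the head.\<close>
  hence "distinct (wr # L1)" "set (wr # L1) = exit_wires (?Y C1)" using wY by auto
  from sequentializable_with_exits[OF Y(2) this] obtain q f1 g1 where
    q: "is_proof d q" "unordered_iso f1 g1 (trans d q) (?Y C1)" "map g1 (exits (trans d q)) = wr # L1"
    by auto
  define T where "T = (\<lambda>i::nat. trans d (if i = 0 then p else q))"
  hence T01: "trans d p = T 0" "trans d q = T (Suc 0)" by simp_all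
  note P = unordered_iso_trans_exits[OF p(1,2), unfolded T01] and Q = unordered_iso_trans_exits[OF q(1,2), unfolded T01]
  obtain es a where ex: "exits (T 0) = es @ [a]" "g0 a = wl"
    using p(3) unfolding T01 by (auto simp: map_eq_append_conv)
  obtain fs b where ex': "exits (T (Suc 0)) = b # fs" "g1 b = wr"
    using q(3) unfolding T01 by auto
  let ?Z = "trans d (PTens p q)"
  note Z = trans_Tens[of d p T q, OF T01 P(1) Q(1) ex(1) ex'(1)]
  interpret glued ?Z "{[]}" "{0, Suc 0}" T by (rule Z(1))
  define f where "f = (\<lambda>i::nat. if i = 0 then f0 else f1)"
  define g where "g = (\<lambda>i::nat. if i = 0 then g0 else g1)"
  have ab: "a \<in> exit_wires (T 0)" "b \<in> exit_wires (T (Suc 0))" unfolding P(2) Q(2) ex ex' by auto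
  have tg0: "tgt X (g0 v) = map_option (\<lambda>_. N) (tgt ?Z (0 # v))" if v: "v \<in> exit_wires (T 0)" for v
  proof (cases "v = a")
    case True thus ?thesis using ex ww[of wl] Z(5)[of v] ab by (auto simp: exit_wires_def)
  next
    case False
    hence "g0 v \<noteq> wl" using P(4) v ab ex(2) by (auto dest: inj_onD)
    moreover have "g0 v \<noteq> wr" using P(3)[OF v] C1wr disj unfolding exit_wires_part by auto
    ultimately have "tgt X (g0 v) = None"
      using P(3)[OF v] w(2) unfolding exit_wires_part In_def by (cases "tgt X (g0 v)") auto
    thus ?thesis using Z(5) False v unfolding exit_wires_def by simp
  qed
  have tg1: "tgt X (g1 v) = map_option (\<lambda>_. N) (tgt ?Z (Suc 0 # v))" if v: "v \<in> exit_wires (T (Suc 0))" for v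
  proof (cases "v = b")
    case True thus ?thesis using ex' ww[of wr] Z(6)[of v] ab by (auto simp: exit_wires_def)
  next
    case False
    hence "g1 v \<noteq> wr" using Q(4) v ab ex'(2) by (auto dest: inj_onD)
    moreover have "g1 v \<noteq> wl" using Q(3)[OF v] C0(2) disj unfolding exit_wires_part by auto
    ultimately have "tgt X (g1 v) = None"
      using Q(3)[OF v] w(2) unfolding exit_wires_part In_def by (cases "tgt X (g1 v)") auto
    thus ?thesis using Z(6) False v unfolding exit_wires_def by simp
  qed
  have "\<exists>F G. unordered_iso F G ?Z X"
  proof (rule glued_unordered_iso[where \<phi> = "\<lambda>_. N" and \<gamma> = "\<lambda>_. ow" and C = C and f = f and g = g])
    show "Out X N = {ow} \<and> tgt X ow = None \<and> lab X ow = lab ?Z x \<and> kind X N = kind ?Z x"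
      if "x \<in> {[]}" for x
      using that w N(2) Z(3,4) P(3)[OF ab(1)] Q(3)[OF ab(2)] ex(2) ex'(2) by simp
    show "unordered_iso (f i) (g i) (T i) (restrict (delete X ((\<lambda>_. N) ` {[]})) (C i))"
      if "i \<in> {0, Suc 0}" for i
      using that p(2) q(2) unfolding T01 f_def g_def C_def by auto
    show "tgt X (g i v) = map_option (\<lambda>_. N) (tgt ?Z (i # v))"
      if "i \<in> {0, Suc 0}" "v \<in> exit_wires (T i)" for i v
      using that tg0 tg1 unfolding g_def by auto
    show "isleft X (g i v) = isleft ?Z (i # v)"
      if "i \<in> {0, Suc 0}" "v \<in> exit_wires (T i)" "tgt ?Z (i # v) = Some x" for i v x
    proof -
      have "i = 0 \<and> v = a \<or> i = Suc 0 \<and> v = b"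
        using that Z(5)[of v] Z(6)[of v] unfolding exit_wires_def by (auto split: if_splits)
      thus ?thesis using Z(7,8) ex(2) ex'(2) w(3,4) unfolding g_def by auto
    qed
    show "comps (delete X ((\<lambda>_. N) ` {[]})) = C ` {0, Suc 0}" "inj_on C {0, Suc 0}"
      using comps unfolding C_def by auto
  qed (use wf N in auto)
  moreover have "is_proof d (PTens p q)"
    using P(5) Q(5) ex ex' unfolding is_proof_def by simp
  ultimately show ?thesis unfolding sequentializable_unordered_def by blast
qed

text \<open>The assumption \<open>left\<close> fixes which component is called \<open>C0\<close>. As
  \<open>E\<close> contains every final node, no exit of \<open>X\<close> survives in the parts, so
  the exits of each part are precisely the wires entering \<open>E\<close>, one for every deleted
  node.\<close>

lemma sequentializable_With:
  assumes pre: "pre_circuit d X" and N: "N \<in> nodes X" "kind X N = KBin BWith"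
  defines "E \<equiv> {m. final X m}"
  assumes NE: "N \<in> E" and contr: "\<And>m. m \<in> E \<Longrightarrow> m \<noteq> N \<Longrightarrow> kind X m = KContr"
    and out: "\<And>w. w \<in> wires X \<Longrightarrow> src X w \<in> E \<Longrightarrow> tgt X w = None"
    and comps: "comps (delete X E) = {C0, C1}" "C0 \<noteq> C1"
    and meet: "\<And>m. m \<in> E \<Longrightarrow> \<exists>w1\<in>In X m. \<exists>w2\<in>In X m. src X w1 \<in> C0 \<and> src X w2 \<in> C1"
    and left: "\<And>w. w \<in> In X N \<Longrightarrow> isleft X w \<Longrightarrow> src X w \<in> C0"
    and parts: "\<And>Y. Y \<in> parts X E \<Longrightarrow> sequentializable_unordered d Y"
  shows "sequentializable_unordered d X"
proof -
  note wf = pre_circuit_wf[OF pre]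
  have C01: "C0 \<in> comps (delete X E)" "C1 \<in> comps (delete X E)" using comps by auto
  have disj: "C0 \<inter> C1 = {}" using comps_disjoint[OF C01] comps(2) by blast
  have CE: "C0 \<subseteq> nodes X - E" "C1 \<subseteq> nodes X - E" using C01[THEN comps_subset] by auto
  have EX: "E \<subseteq> nodes X" unfolding E_def final_def by auto
  have outN: "\<And>w. w \<in> wires X \<Longrightarrow> src X w = N \<Longrightarrow> tgt X w = None" using out NE by auto
  obtain wl wr ow where w: "wl \<noteq> wr" "In X N = {wl, wr}" "isleft X wl" "\<not> isleft X wr"
    "Out X N = {ow}" "tgt X ow = None" "lab X ow = With (lab X wl) (lab X wr)"
    and ww: "\<forall>w\<in>{wl, wr}. w \<in> wires X \<and> tgt X w = Some N \<and> src X w \<in> nodes X \<and> src X w \<noteq> N"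
    by (rule node_ok_BinE[OF pre N outN, unfolded binf.simps])
  have "\<forall>m\<in>E. \<exists>u v c. In X m = {u, v} \<and> src X u \<in> C0 \<and> src X v \<in> C1 \<and> Out X m = {c}
      \<and> (m \<noteq> N \<longrightarrow> lab X u = lab X c \<and> lab X v = lab X c)"
  proof
    fix m assume m: "m \<in> E"
    obtain u v where uv: "u \<in> In X m" "v \<in> In X m" "src X u \<in> C0" "src X v \<in> C1"
      using meet[OF m] by auto
    have "u \<noteq> v" using uv disj by auto
    show "\<exists>u v c. In X m = {u, v} \<and> src X u \<in> C0 \<and> src X v \<in> C1 \<and> Out X m = {c}
      \<and> (m \<noteq> N \<longrightarrow> lab X u = lab X c \<and> lab X v = lab X c)"
    proof (cases "m = N")
      case True
      hence "In X m = {u, v}" using uv \<open>u \<noteq> v\<close> w(2) by auto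
      thus ?thesis using uv w(5) True by auto
    next
      case False
      have "node_ok d X m" using pre m EX unfolding pre_circuit_def by auto
      then obtain w1 w2 c where c: "In X m = {w1, w2}" "Out X m = {c}"
        "lab X w1 = lab X c" "lab X w2 = lab X c"
        using contr[OF m False] unfolding node_ok_def by auto
      have "In X m = {u, v}" "lab X u = lab X c" "lab X v = lab X c"
        using c uv \<open>u \<noteq> v\<close> by auto
      thus ?thesis using uv c by auto
    qed
  qed
  \<comment> \<open>Contraction inputs carry no designation, so they are told apart by component:
    \<open>u m\<close> comes from \<open>C0\<close> and \<open>v m\<close> from \<open>C1\<close>,
    while \<open>c m\<close> is the output of \<open>m\<close>.\<close>
  then obtain u v c where uvc: "\<And>m. m \<in> E \<Longrightarrow> In X m = {u m, v m} \<and> src X (u m) \<in> C0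
      \<and> src X (v m) \<in> C1 \<and> Out X m = {c m}
      \<and> (m \<noteq> N \<longrightarrow> lab X (u m) = lab X (c m) \<and> lab X (v m) = lab X (c m))"
    by metis
  have uw: "u m \<in> wires X" "v m \<in> wires X" "tgt X (u m) = Some m" "tgt X (v m) = Some m" if "m \<in> E" for m
  proof -
    have "u m \<in> In X m" "v m \<in> In X m" using uvc[OF that] by auto
    thus "u m \<in> wires X" "v m \<in> wires X" "tgt X (u m) = Some m" "tgt X (v m) = Some m"
      unfolding In_def by auto
  qed
  have cw: "c m \<in> wires X" "src X (c m) = m" "tgt X (c m) = None" if "m \<in> E" for m
  proof -
    have "c m \<in> Out X m" using uvc[OF that] by auto
    thus "c m \<in> wires X" "src X (c m) = m" unfolding Out_def by auto
    thus "tgt X (c m) = None" using out that by auto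
  qed
  have wluv: "wl = u N" "wr = v N" and cN: "c N = ow"
  proof -
    have "src X wl \<in> C0" using left w by auto
    hence "wl \<noteq> v N" using uvc[OF NE] disj by auto
    thus "wl = u N" "wr = v N" using uvc[OF NE] w(1,2) by (auto simp: doubleton_eq_iff)
    show "c N = ow" using uvc[OF NE] w(5) by auto
  qed
  let ?Y = "\<lambda>C. restrict (delete X E) C"
  have Y: "sequentializable_unordered d (?Y C0)" "sequentializable_unordered d (?Y C1)"
    using parts comps unfolding parts_def by auto
  \<comment> \<open>A surviving wire that was an exit of \<open>X\<close> already would make its
    source final and hence deleted.\<close>
  have exY: "\<exists>m\<in>E. w \<in> In X m" if "w \<in> exit_wires (?Y C)" for w C
  proof -
    have w: "w \<in> wires X" "src X w \<notin> E" "\<forall>t. tgt X w = Some t \<longrightarrow> t \<in> E"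
      using that unfolding exit_wires_part by auto
    have "tgt X w \<noteq> None"
      using w(1,2) wf unfolding E_def final_def wf_circuit_def by auto
    thus ?thesis using w unfolding In_def by auto
  qed
  have exY0: "exit_wires (?Y C0) = u ` E"
  proof
    show "exit_wires (?Y C0) \<subseteq> u ` E"
    proof
      fix w assume w: "w \<in> exit_wires (?Y C0)"
      then obtain m where m: "m \<in> E" "w \<in> In X m" using exY by blast
      have "w \<noteq> v m" using w uvc[OF m(1)] disj unfolding exit_wires_part by auto
      thus "w \<in> u ` E" using m uvc[OF m(1)] by auto
    qed
    show "u ` E \<subseteq> exit_wires (?Y C0)"
    proof
      fix w assume "w \<in> u ` E"
      then obtain m where m: "m \<in> E" "w = u m" by auto
      thus "w \<in> exit_wires (?Y C0)" using uvc[OF m(1)] uw[OF m(1)] CE by (auto simp: exit_wires_part)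
    qed
  qed
  have exY1: "exit_wires (?Y C1) = v ` E"
  proof
    show "exit_wires (?Y C1) \<subseteq> v ` E"
    proof
      fix w assume w: "w \<in> exit_wires (?Y C1)"
      then obtain m where m: "m \<in> E" "w \<in> In X m" using exY by blast
      have "w \<noteq> u m" using w uvc[OF m(1)] disj unfolding exit_wires_part by auto
      thus "w \<in> v ` E" using m uvc[OF m(1)] by auto
    qed
    show "v ` E \<subseteq> exit_wires (?Y C1)"
    proof
      fix w assume "w \<in> v ` E"
      then obtain m where m: "m \<in> E" "w = v m" by auto
      thus "w \<in> exit_wires (?Y C1)" using uvc[OF m(1)] uw[OF m(1)] CE by (auto simp: exit_wires_part)
    qed
  qed
  have "finite E" using pre EX finite_subset unfolding pre_circuit_def by blast
  \<comment> \<open>One enumeration of the contraction nodes orders the exits of both parts, with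
    the wire into \<open>N\<close> last, so that the contexts of the two premises match position by
    position.\<close>
  then obtain ms where ms: "distinct ms" "set ms = E - {N}" using finite_distinct_list[of "E - {N}"] by auto
  have E: "E = insert N (set ms)" "distinct (ms @ [N])" "set (ms @ [N]) = E" using ms NE by auto
  \<comment> \<open>The target of \<open>u m\<close>, and likewise of \<open>v m\<close>, is
    \<open>m\<close>.\<close>
  have "inj_on u E" "inj_on v E" using uw unfolding inj_on_def by (metis option.inject)+
  hence "distinct (map u (ms @ [N]))" "distinct (map v (ms @ [N]))"
    using E by (auto simp: distinct_map intro: inj_on_subset)
  moreover have "set (map u (ms @ [N])) = exit_wires (?Y C0)" "set (map v (ms @ [N])) = exit_wires (?Y C1)"
    by (simp_all only: set_map E(3) exY0 exY1)
  ultimately obtain p f0 g0 q f1 g1 where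
    p: "is_proof d p" "unordered_iso f0 g0 (trans d p) (?Y C0)" "map g0 (exits (trans d p)) = map u (ms @ [N])"
    and q: "is_proof d q" "unordered_iso f1 g1 (trans d q) (?Y C1)" "map g1 (exits (trans d q)) = map v (ms @ [N])"
    using sequentializable_with_exits[OF Y(1)] sequentializable_with_exits[OF Y(2)] by metis
  define T where "T = (\<lambda>i::nat. trans d (if i = 0 then p else q))"
  hence T01: "trans d p = T 0" "trans d q = T (Suc 0)" by simp_all
  note P = unordered_iso_trans_exits[OF p(1,2), unfolded T01] and Q = unordered_iso_trans_exits[OF q(1,2), unfolded T01]
  obtain es a where ex: "exits (T 0) = es @ [a]" "g0 a = u N" "map g0 es = map u ms"
    using p(3) unfolding T01 by (auto simp: map_eq_append_conv)
  obtain fs b where ex': "exits (T (Suc 0)) = fs @ [b]" "g1 b = v N" "map g1 fs = map v ms"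
    using q(3) unfolding T01 by (auto simp: map_eq_append_conv)
  have len: "length es = length ms" "length fs = length ms" "length fs = length es"
    using arg_cong[OF ex(3), of length] arg_cong[OF ex'(3), of length] by auto
  have nth: "g0 (es ! j) = u (ms ! j)" "g1 (fs ! j) = v (ms ! j)" "ms ! j \<in> E" "ms ! j \<noteq> N"
    if "j < length es" for j
  proof -
    show "g0 (es ! j) = u (ms ! j)" using arg_cong[OF ex(3), of "\<lambda>l. l ! j"] that len by simp
    show "g1 (fs ! j) = v (ms ! j)" using arg_cong[OF ex'(3), of "\<lambda>l. l ! j"] that len by simp
    have "ms ! j \<in> set ms" using that len by simp
    thus "ms ! j \<in> E" "ms ! j \<noteq> N" using ms(2) by auto
  qed
  let ?Z = "trans d (PWith p q)"
  note Z = trans_With[of d p T q, OF T01 P(1) Q(1) ex(1) ex'(1) len(3)]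
  let ?D = "insert [] ((\<lambda>j. [2, j]) ` {..<length es})"
  interpret glued ?Z ?D "{0, Suc 0}" T by (rule Z(1))
  have exT: "exit_wires (T 0) = set (es @ [a])" "exit_wires (T (Suc 0)) = set (fs @ [b])"
    unfolding P(2) Q(2) ex ex' by auto
  have labT: "lab (T 0) w = lab X (g0 w)" if "w \<in> set (es @ [a])" for w using P(3) that exT by simp
  have labT': "lab (T (Suc 0)) w = lab X (g1 w)" if "w \<in> set (fs @ [b])" for w using Q(3) that exT by simp
  define C where "C = (\<lambda>i::nat. if i = 0 then C0 else C1)"
  define f where "f = (\<lambda>i::nat. if i = 0 then f0 else f1)"
  define g where "g = (\<lambda>i::nat. if i = 0 then g0 else g1)"
  \<comment> \<open>The entry at position 1 of a contraction name \<open>[2, j]\<close> is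
    \<open>j\<close>.\<close>
  define \<phi> where "\<phi> = (\<lambda>x::nat list. if x = [] then N else ms ! (x ! 1))"
  have \<phi>: "\<phi> [] = N" "\<phi> [2, j] = ms ! j" for j unfolding \<phi>_def by auto
  have \<phi>E: "\<phi> ` ?D = E"
    unfolding E(1) by (auto simp: \<phi> image_image set_conv_nth len)
  have exits_cases: "(v = (if i = 0 then a else b) \<and> tgt ?Z (i # v) = Some [])
      \<or> (\<exists>j<length es. v = (if i = 0 then es ! j else fs ! j) \<and> tgt ?Z (i # v) = Some [2, j])"
    if "i \<in> {0, Suc 0}" "v \<in> exit_wires (T i)" for i v
    using that Z(6-8) exT len(3) by (auto simp: in_set_conv_nth)
  have "\<exists>F G. unordered_iso F G ?Z X"
  proof (rule glued_unordered_iso[where \<phi> = \<phi> and \<gamma> = "\<lambda>x. c (\<phi> x)" and C = C and f = f and g = g,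
        unfolded \<phi>E])
    show "inj_on \<phi> ?D"
      using nth(4) ms(1) by (auto simp: inj_on_def \<phi> nth_eq_iff_index_eq len)
    show "comps (delete X E) = C ` {0, Suc 0}" "inj_on C {0, Suc 0}"
      using comps unfolding C_def by auto
    show "unordered_iso (f i) (g i) (T i) (restrict (delete X E) (C i))"
      if "i \<in> {0, Suc 0}" for i
      using that p(2) q(2) unfolding T01 f_def g_def C_def by auto
    show "Out X (\<phi> x) = {c (\<phi> x)} \<and> tgt X (c (\<phi> x)) = None \<and> lab X (c (\<phi> x)) = lab ?Z x
        \<and> kind X (\<phi> x) = kind ?Z x" if x: "x \<in> ?D" for x
    proof (cases "x = []")
      case True
      thus ?thesis using w N(2) Z(3,4) labT[of a] labT'[of b] ex ex' wluv cN by (simp add: \<phi>)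
    next
      case False
      then obtain j where j: "j < length es" "x = [2, j]" using x by auto
      note n = nth[OF j(1)]
      show ?thesis
        using Z(5)[OF j(1)] n uvc[OF n(3)] cw[OF n(3)] contr[OF n(3,4)] labT[of "es ! j"] j
        by (simp add: \<phi>)
    qed
    show "tgt X (g i v) = map_option \<phi> (tgt ?Z (i # v))"
      if i: "i \<in> {0, Suc 0}" "v \<in> exit_wires (T i)" for i v
      using exits_cases[OF i] i(1) ex(2) ex'(2) nth uw NE unfolding g_def
      by (auto simp: \<phi>)
    show "isleft X (g i v) = isleft ?Z (i # v)"
      if i: "i \<in> {0, Suc 0}" "v \<in> exit_wires (T i)" and t: "tgt ?Z (i # v) = Some x" "kind ?Z x \<noteq> KContr"
      for i v x
    proof -
      have "v = (if i = 0 then a else b)" using exits_cases[OF i] t Z(5) by auto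
      thus ?thesis using i(1) Z(9,10) ex(2) ex'(2) w(3,4) wluv unfolding g_def by auto
    qed
  qed (use wf EX in auto)
  \<comment> \<open>Both inputs of a contraction carry the label of its output, which gives the
    equal contexts that \<open>PWith\<close> requires.\<close>
  moreover have "map (lab (T 0)) es = map (lab (T (Suc 0))) fs"
  proof (rule nth_equalityI)
    fix j assume "j < length (map (lab (T 0)) es)"
    hence j: "j < length es" by simp
    show "map (lab (T 0)) es ! j = map (lab (T (Suc 0))) fs ! j"
      using labT[of "es ! j"] labT'[of "fs ! j"] nth[OF j] uvc[OF nth(3)[OF j]] j len by simp
  qed (simp add: len)
  hence "is_proof d (PWith p q)"
    using P(5) Q(5) ex ex' unfolding is_proof_def by simp
  ultimately show ?thesis unfolding sequentializable_unordered_def by blast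
qed

lemma sequentializable_Ax:
  assumes pre: "pre_circuit d X" and N: "nodes X = {N}" "kind X N = KAx"
  shows "sequentializable_unordered d X"
proof -
  have "node_ok d X N" using pre N unfolding pre_circuit_def by auto
  then obtain w1 w2 P where w: "w1 \<noteq> w2" "Out X N = {w1, w2}" "lab X w1 = Lit P" "lab X w2 = Lit (d P)"
    using N(2) unfolding node_ok_def by auto
  have W: "src X w = N" "tgt X w = None" if "w \<in> wires X" for w
  proof -
    show s: "src X w = N" using that pre N unfolding pre_circuit_def by auto
    \<comment> \<open>A target would be a node distinct from the source, but there is only one
      node.\<close>
    show "tgt X w = None"
      using that pre N s unfolding pre_circuit_def by (cases "tgt X w") auto
  qed
  hence wX: "wires X = {w1, w2}" using w(2) unfolding Out_def by auto
  let ?g = "\<lambda>w. if w = [0] then w1 else w2"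
  have "unordered_iso (\<lambda>_. N) ?g (trans d (PAx P)) X"
    using W w N wX by (auto simp: trans.simps unordered_iso_def graph_iso_def bij_betw_def designated_def)
  moreover have "is_proof d (PAx P)" by (simp add: is_proof_def)
  ultimately show ?thesis unfolding sequentializable_unordered_def by blast
qed

text \<open>Nodes of all other kinds have a single outgoing wire, which finality makes an exit. An
  axiom node can be final and still have its other wire lead to a node.\<close>

lemma final_not_Ax_out:
  assumes "pre_circuit d X" "final X n" "kind X n \<noteq> KAx" "w \<in> wires X" "src X w = n"
  shows "tgt X w = None"
proof -
  obtain w' where w': "w' \<in> Out X n" "tgt X w' = None"
    using assms(2) unfolding final_def Out_def by auto
  have "node_ok d X n" using assms(1,2) unfolding pre_circuit_def final_def by auto
  then obtain o' where "Out X n = {o'}"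
    using assms(3) unfolding node_ok_def by (cases "kind X n") auto
  moreover have "w \<in> Out X n" using assms(4,5) unfolding Out_def by auto
  ultimately show ?thesis using w' by auto
qed

lemma erase_at_sequentializable:
  assumes pre: "pre_circuit d X" and er: "erase_at X N S"
    and S: "\<And>Y. Y \<in> S \<Longrightarrow> pre_circuit d Y \<Longrightarrow> sequentializable_unordered d Y"
  shows "sequentializable_unordered d X"
proof -
  have fin: "final X N" and N: "N \<in> nodes X" using er unfolding erase_at_def final_def by auto
  have S': "sequentializable_unordered d Y"
    if "\<And>w. w \<in> wires X \<Longrightarrow> src X w \<in> E \<Longrightarrow> tgt X w = None" "S = parts X E" "Y \<in> parts X E" for E Y
    using S[of Y] that pre_circuit_part[OF pre that(1)] unfolding parts_def by blast
  from er show ?thesis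
  proof (cases rule: erase_at_cases)
    case single
    have out: "\<And>w. w \<in> wires X \<Longrightarrow> src X w = N \<Longrightarrow> tgt X w = None"
      using final_not_Ax_out[OF pre fin] single by auto
    have Y: "\<And>Y. Y \<in> parts X {N} \<Longrightarrow> sequentializable_unordered d Y"
      using S'[of "{N}"] out single(2) by auto
    show ?thesis
      using single(1) sequentializable_Plus[OF pre N _ out Y] sequentializable_Tens[OF pre N _ out _ Y]
        sequentializable_Par[OF pre N _ out _ Y] by blast
  next
    case (amp X1 X2)
    let ?E = "{m. final X m}"
    have ker: "kind X m = KContr" if "m \<in> ?E" "m \<noteq> N" for m using amp(2) that by auto
    have out: "tgt X w = None" if "w \<in> wires X" "src X w \<in> ?E" for w
    proof -
      have "kind X (src X w) \<noteq> KAx" using amp(1) ker[OF that(2)] by (cases "src X w = N") auto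
      thus ?thesis using final_not_Ax_out[OF pre _ _ that(1) refl] that(2) by auto
    qed
    have Y: "\<And>Y. Y \<in> parts X ?E \<Longrightarrow> sequentializable_unordered d Y"
      using S'[of ?E] out amp(6) by auto
    have NE: "N \<in> ?E" using fin by simp
    have m1: "\<exists>w1\<in>In X m. \<exists>w2\<in>In X m. src X w1 \<in> X1 \<and> src X w2 \<in> X2" if "m \<in> ?E" for m
      using amp(5) that by auto
    have m2: "\<exists>w1\<in>In X m. \<exists>w2\<in>In X m. src X w1 \<in> X2 \<and> src X w2 \<in> X1" if "m \<in> ?E" for m
      using m1[OF that] by blast
    have "tgt X w = None" if "w \<in> wires X" "src X w = N" for w using out[of w] that fin by simp
    then obtain wl wr where w: "In X N = {wl, wr}" "isleft X wl" "\<not> isleft X wr"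
      by (rule node_ok_BinE[OF pre N amp(1)])
    hence wl: "w = wl" if "w \<in> In X N" "isleft X w" for w using that by auto
    have "X1 \<inter> X2 = {}" using comps_disjoint[of X1 "delete X ?E" X2] amp(3,4) by auto
    \<comment> \<open>Readiness is symmetric in \<open>X1\<close> and \<open>X2\<close>; whichever
      of them contains the source of the left input takes the role of \<open>C0\<close>.\<close>
    hence "src X wl \<in> X1 \<or> src X wl \<in> X2" using m1[OF NE] w(1) by auto
    thus ?thesis
    proof
      assume "src X wl \<in> X1"
      thus ?thesis
        by (intro sequentializable_With[OF pre N amp(1) NE ker out amp(4,3) m1 _ Y]) (use wl in auto)
    next
      assume "src X wl \<in> X2"
      moreover have "comps (delete X ?E) = {X2, X1}" "X2 \<noteq> X1" using amp(3,4) by auto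
      ultimately show ?thesis
        by (intro sequentializable_With[OF pre N amp(1) NE ker out _ _ m2 _ Y]) (use wl in auto)
    qed
  next
    case ax
    thus ?thesis using sequentializable_Ax[OF pre] by auto
  qed
qed

text \<open>The statement covers every member of the current set: after a step, the untouched
  members are still present and the parts of the erased circuit have joined them, so the induction
  hypothesis applies to both.\<close>

lemma erasable_sequentializable_unordered:
  assumes "step_set\<^sup>*\<^sup>* T {}" "X \<in> T" "pre_circuit d X"
  shows "sequentializable_unordered d X"
  using assms
proof (induction arbitrary: X rule: converse_rtranclp_induct)
  case (step T U)
  obtain Y T' N S where T: "T = insert Y T'" "erase_at Y N S" "U = T' \<union> S"
    using step(1) unfolding step_set_def by auto
  show ?case
  proof (cases "X \<in> T'")
    case True thus ?thesis using step T by auto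
  next
    case False
    hence "X = Y" using step T by auto
    thus ?thesis using erase_at_sequentializable[OF step.prems(2), of N S] T step.IH by auto
  qed
qed auto

theorem mainTheorem4:
  fixes dual :: "'a \<Rightarrow> 'a" and X :: "('n, 'w, 'a) circuit"
  assumes "\<forall>a. dual (dual a) = a" and "\<forall>a. dual a \<noteq> a"
    and "is_circuit dual X"
  shows "(erasable X \<longleftrightarrow> sequentializable dual X)
       \<and> (\<forall>p. is_proof dual p \<longrightarrow> erasable (trans dual p))"
proof (intro conjI iffI allI impI)
  have pre: "pre_circuit dual X" and ex: "distinct (exits X)" "set (exits X) = exit_wires X"
    using assms(3) unfolding is_circuit_def pre_circuit_def exit_wires_def by auto
  show "sequentializable dual X" if "erasable X"
  proof -
    have "sequentializable_unordered dual X"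
      using erasable_sequentializable_unordered[of "{X}"] that pre unfolding erasable_def by auto
    \<comment> \<open>Prescribing the exit list of \<open>X\<close> itself upgrades the unordered
      isomorphism to one that respects the order of the exits.\<close>
    thus ?thesis using sequentializable_with_exits[OF _ ex]
      unfolding sequentializable_def iso_iff_unordered_iso by metis
  qed
  have er: "hereditarily_erasable (trans dual p) \<and> wf_circuit (trans dual p)" if "is_proof dual p" for p
    using that trans_hereditarily_erasable concl_exits(1) unfolding is_proof_def trans_inv_def by blast
  show "erasable (trans dual p)" if "is_proof dual p" for p
    using er[OF that] hereditarily_erasable_imp_erasable by blast
  show "erasable X" if seq: "sequentializable dual X"
  proof -
    obtain p f g where p: "is_proof dual p" "graph_iso f g (trans dual p) X"
      using seq unfolding sequentializable_def iso_iff_unordered_iso unordered_iso_def by auto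
    thus ?thesis
      using hereditarily_erasable_graph_iso er hereditarily_erasable_imp_erasable by blast
  qed
qed

end
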